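(* (i) For every integer $1\le n\le 4$, the map $\Phi$ restricted to $\mathbb{M}^{(n)}_{\leq}$ is an isometric embedding, i.e. for all $D,D'\in \mathbb{M}^{(n)}_{\leq}$, $$\mathbf{\Delta}(\Phi(D),\Phi(D')) = d_{\mathbb{M}^{(n)}}(D,D').$$ (ii) For every integer $n\ge 1$ and all $D,D'\in\mathbb{M}^{(n)}_{\leq}$ that are Euclidean, $$\mathbf{\Delta}(\Phi(D),\Phi(D')) = d_{\mathbb{M}^{(n)}}(D,D').$$
   Context: Let $n\ge 1$. $M^{(n)}$ is the space of real symmetric $n\times n$ matrices with zero diagonal, with norm $\|f\|^2=\frac1{n^2}\sum_{i,j=1}^n f_{ij}^2$. The symmetric group $\mathfrak{S}_n$ acts on it by $(\sigma^*g)_{ij}=g_{\sigma_i\sigma_j}$. The quotient $\mathbb{M}^{(n)}=M^{(n)}/\mathfrak{S}_n$ carries the distance $$d_{\mathbb{M}^{(n)}}(f,g)=\min_{\sigma\in\mathfrak{S}_n}\|f-\sigma^*g\|=\min_{\sigma\in\mathfrak{S}_n}\Big(\frac1{n^2}\sum_{i,j=1}^n|f_{ij}-g_{\sigma_i\sigma_j}|^2\Big)^{1/2}.$$ $M^{(n)}_{\leq}\subset M^{(n)}$ is the set of matrices $D$ with $D_{ij}\le D_{ik}+D_{kj}$ for all $i,j,k$ (distance matrices of $n$-point pseudo-metric spaces), and $\mathbb{M}^{(n)}_{\leq}=M^{(n)}_{\leq}/\mathfrak{S}_n\subset\mathbb{M}^{(n)}$. $D\in\mathbb{M}^{(n)}_{\leq}$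 is called Euclidean if for some $k\in\mathbb{N}$ there are points $y_1,\dots,y_n\in\mathbb{R}^k$ with $D_{ij}=\|y_i-y_j\|_2$ for all $i,j$ (for a representative matrix; this does not depend on the representative). A gauged measure space is a triple $(X,f,m)$ with $X$ a Polish space, $m$ a Borel probability measure on $X$ and $f\in L^2(X\times X,m\otimes m)$ symmetric. The $L^2$-distortion distance is $$\mathbf{\Delta}((X_1,f_1,m_1),(X_2,f_2,m_2))=\inf_{\bar m}\Big(\int_{X_1\times X_2}\int_{X_1\times X_2}|f_1(x_1,y_1)-f_2(x_2,y_2)|^2\,d\bar m(x_1,x_2)\,d\bar m(y_1,y_2)\Big)^{1/2},$$ the infimum being over all couplings $\bar m$ of $m_1$ and $m_2$ (probability measures on $X_1\times X_2$ with marginals $m_1,m_2$). Two gauged measure spaces are homomorphic if their $\mathbf{\Delta}$-distance is $0$; $\mathbb{Y}$ is the space of homomorphism classes, with distance $\mathbf{\Delta}$. The map $\Phi:\mathbb{M}^{(n)}\to\mathbb{Y}$ sends $f$ to the class of $(\{1,\dots,n\},f,\frac1n\sum_{i=1}^n\delta_i)$. *)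

theory Defs
  imports "HOL-Probability.Probability"
begin

section \<open>Symmetric matrices modulo relabelling\<close>

text \<open>The index set \<open>{1,...,n}\<close> is an arbitrary finite type \<open>'n\<close> with \<open>CARD('n) = n\<close>.\<close>

definition sym_matrices :: "(real^'n^'n::finite) set" where
  "sym_matrices = {f. (\<forall>i. f $ i $ i = 0) \<and> (\<forall>i j. f $ i $ j = f $ j $ i)}"

definition distance_matrices :: "(real^'n^'n::finite) set" where
  "distance_matrices =
     {D \<in> sym_matrices. \<forall>i j k. D $ i $ j \<le> D $ i $ k + D $ k $ j}"

definition matrix_nrm :: "real^'n^'n::finite \<Rightarrow> real" where
  "matrix_nrm f = sqrt (1 / (real CARD('n))\<^sup>2 * (\<Sum>i\<in>UNIV. \<Sum>j\<in>UNIV. (f $ i $ j)\<^sup>2))"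

definition relabel :: "('n \<Rightarrow> 'n) \<Rightarrow> real^'n^'n::finite \<Rightarrow> real^'n^'n" where
  "relabel \<sigma> g = (\<chi> i j. g $ \<sigma> i $ \<sigma> j)"

definition relabel_orbit :: "real^'n^'n::finite \<Rightarrow> (real^'n^'n) set" where
  "relabel_orbit f = {relabel \<sigma> f | \<sigma>. bij \<sigma>}"

definition distance_matrix_classes :: "(real^'n^'n::finite) set set" where
  "distance_matrix_classes = relabel_orbit ` distance_matrices"

definition matrix_dist :: "real^'n^'n::finite \<Rightarrow> real^'n^'n \<Rightarrow> real" where
  "matrix_dist f g = Min ((\<lambda>\<sigma>. matrix_nrm (f - relabel \<sigma> g)) ` {\<sigma>. bij \<sigma>})"

text \<open>Here and below, a function on classes that is defined through representatives is the
  unique element of the set of its values on all representatives.\<close>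

definition matrix_class_dist :: "(real^'n^'n::finite) set \<Rightarrow> (real^'n^'n) set \<Rightarrow> real" where
  "matrix_class_dist A B = the_elem ((\<lambda>(f, g). matrix_dist f g) ` (A \<times> B))"

text \<open>Points of \<open>\<real>\<^sup>k\<close> are given by their coordinates with index below \<open>k\<close>;
  the values at other indices play no role.\<close>

definition euclidean_matrix :: "real^'n^'n::finite \<Rightarrow> bool" where
  "euclidean_matrix D \<longleftrightarrow>
     (\<exists>(k::nat) (y :: 'n \<Rightarrow> nat \<Rightarrow> real). \<forall>i j. D $ i $ j = L2_set (\<lambda>l. y i l - y j l) {..<k})"

definition euclidean_class :: "(real^'n^'n::finite) set \<Rightarrow> bool" where
  "euclidean_class A \<longleftrightarrow> (\<exists>D\<in>A. euclidean_matrix D)"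


section \<open>Gauged measure spaces\<close>

definition polish_topology :: "'a topology \<Rightarrow> bool" where
  "polish_topology X \<longleftrightarrow> completely_metrizable_space X \<and> separable_space X"

record 'a gauged_space =
  points :: "'a topology"
  gauging :: "'a \<Rightarrow> 'a \<Rightarrow> real"
  mass :: "'a measure"

text \<open>The gauge is a representative of an element of \<open>L\<^sup>2\<close>, so its symmetry is required
  almost everywhere. As the space is second countable, the product \<open>\<sigma>\<close>-algebra
  is the Borel \<open>\<sigma>\<close>-algebra of the product topology.\<close>

definition gauged_measure_space :: "'a gauged_space \<Rightarrow> bool" where
  "gauged_measure_space G \<longleftrightarrow>
     polish_topology (points G) \<and>
     sets (mass G) = sets (sigma (topspace (points G)) {U. openin (points G) U}) \<and>
     prob_space (mass G) \<and>
     (\<lambda>(x, y). gauging G x y) \<in> borel_measurable (mass G \<Otimes>\<^sub>M mass G) \<and>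
     integrable (mass G \<Otimes>\<^sub>M mass G) (\<lambda>(x, y). (gauging G x y)\<^sup>2) \<and>
     (AE (x, y) in mass G \<Otimes>\<^sub>M mass G. gauging G x y = gauging G y x)"

definition couplings :: "'a measure \<Rightarrow> 'b measure \<Rightarrow> ('a \<times> 'b) measure set" where
  "couplings m1 m2 =
     {m. sets m = sets (m1 \<Otimes>\<^sub>M m2) \<and> prob_space m \<and>
         distr m m1 fst = m1 \<and> distr m m2 snd = m2}"

text \<open>For gauged measure spaces the integrand below is integrable with respect to
  \<open>m \<Otimes>\<^sub>M m\<close> for every coupling \<open>m\<close>, so the Bochner integrals have no degenerate values.
  The set of couplings contains the product measure.\<close>

definition distortion_dist :: "'a gauged_space \<Rightarrow> 'b gauged_space \<Rightarrow> real" where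
  "distortion_dist G H =
     (INF m \<in> couplings (mass G) (mass H).
        sqrt (\<integral>(y1, y2). (\<integral>(x1, x2). \<bar>gauging G x1 y1 - gauging H x2 y2\<bar>\<^sup>2 \<partial>m) \<partial>m))"

definition homomorphic :: "'a gauged_space \<Rightarrow> 'b gauged_space \<Rightarrow> bool" where
  "homomorphic G H \<longleftrightarrow> distortion_dist G H = 0"

text \<open>A class has to consist of spaces over one fixed type of points. A Polish space has at most
  continuum many points, and \<^typ>\<open>'a topology\<close> has an arbitrary carrier, so every
  Polish space is homeomorphic to one over \<^typ>\<open>real\<close>. Hence these classes lose nothing.
  The topology of the representatives is unrelated to that of the real line.\<close>

definition homomorphism_class :: "'a gauged_space \<Rightarrow> real gauged_space set" where
  "homomorphism_class G = {H. gauged_measure_space H \<and> homomorphic G H}"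

definition distortion_class_dist :: "real gauged_space set \<Rightarrow> real gauged_space set \<Rightarrow> real" where
  "distortion_class_dist A B = the_elem ((\<lambda>(G, H). distortion_dist G H) ` (A \<times> B))"

definition matrix_space :: "real^'n^'n::finite \<Rightarrow> 'n gauged_space" where
  "matrix_space f =
     \<lparr>points = discrete_topology UNIV, gauging = (\<lambda>i j. f $ i $ j), mass = uniform_count_measure UNIV\<rparr>"

lemma gauged_measure_space_matrix_space:
  fixes f :: "real^'n^'n::finite"
  assumes "f \<in> sym_matrices"
  shows "gauged_measure_space (matrix_space f)"
proof -
  let ?m = "uniform_count_measure (UNIV :: 'n set)"
  interpret m: prob_space ?m
    by (rule prob_space_uniform_count_measure) auto
  interpret p: pair_prob_space ?m ?m ..
  have "sets (?m \<Otimes>\<^sub>M ?m) = sets (count_space UNIV \<Otimes>\<^sub>M count_space UNIV)"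
    by (intro sets_pair_measure_cong sets_uniform_count_measure_count_space)
  also have "\<dots> = UNIV"
    by (subst sets_pair_countable) auto
  finally have sets_p: "sets (?m \<Otimes>\<^sub>M ?m) = UNIV" .
  have space_p: "space (?m \<Otimes>\<^sub>M ?m) = UNIV"
    by (simp add: space_pair_measure space_uniform_count_measure)
  have meas: "h \<in> borel_measurable (?m \<Otimes>\<^sub>M ?m)" for h :: "'n \<times> 'n \<Rightarrow> real"
    by (simp add: measurable_def sets_p)
  have "integrable (?m \<Otimes>\<^sub>M ?m) h" for h :: "'n \<times> 'n \<Rightarrow> real"
  proof (rule p.integrable_const_bound)
    show "AE z in ?m \<Otimes>\<^sub>M ?m. norm (h z) \<le> Max (range (\<lambda>z. norm (h z)))"
      by (intro always_eventually allI Max_ge) auto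
  qed (rule meas)
  moreover have "sets ?m = sets (sigma (UNIV :: 'n set) UNIV)"
    by (auto simp: sets_uniform_count_measure)
  moreover have "polish_topology (discrete_topology (UNIV :: 'n set))"
    by (simp add: polish_topology_def completely_metrizable_space_discrete_topology
        separable_space_discrete_topology countable_finite)
  ultimately show ?thesis
    using assms meas m.prob_space_axioms
    by (simp add: gauged_measure_space_def matrix_space_def sym_matrices_def)
qed

definition Phi :: "(real^'n^'n::finite) set \<Rightarrow> real gauged_space set" where
  "Phi A = the_elem ((\<lambda>f. homomorphism_class (matrix_space f)) ` A)"

end

theory Submission
  imports Defs "HOL-Real_Asymp.Real_Asymp"
begin

text \<open>
  A coupling of two uniform measures on \<open>n\<close> points is \<open>1/n\<close> times a doubly stochastic
  matrix \<open>P\<close>, and its squared distortion is a constant minus a multiple of the quadratic form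
  \<open>\<Sum> P i k * P j l * (f i j * g k l)\<close>. Permutations are special couplings, so
  the distortion distance never exceeds the distance of the matrices modulo relabelling, and equality
  means that this form is maximised over doubly stochastic matrices by a permutation. That is so as
  soon as the form is convex along the directions \<open>Z\<close> with vanishing row and column sums
  (\<open>overlap_le_permutation\<close>): a matrix with a fractional entry can be moved along such a
  direction, without decreasing the form, until its support becomes smaller.

  Convexity holds if \<open>f\<close> and \<open>g\<close> are of negative type
  (\<open>neg_type_tensor\<close>): modulo constants, which \<open>Z\<close> annihilates, \<open>-f\<close>
  and \<open>-g\<close> are then positive semidefinite, and so is their tensor product. Both cases of the
  theorem are instances. Euclidean distances are of negative type by Schoenberg's theorem
  (\<open>neg_type_euclidean\<close>), and a pseudo-metric on at most four points is a nonnegative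
  combination of cut pseudo-metrics (\<open>four_point_cuts\<close>), each of which is of negative type.

  It remains to see that the distance of two classes is the distance of the matrix spaces that
  generate them. If a gauged measure space \<open>G\<close> is at distance zero from a finite
  space \<open>F\<close>, then \<open>G\<close> and \<open>F\<close> have the same distance to every third space.
  This is a triangle inequality, hence a gluing of couplings; one of the two glued couplings always
  has a finite marginal, which makes it absolutely continuous with respect to the product of its
  marginals, and the gluing is then given by a density (\<open>glue_couplings\<close>) without any
  disintegration theorem.
\<close>

section \<open>Schur multipliers and kernels of negative type\<close>

lemma sum_UNIV_prod:
  fixes h :: "'a::finite \<times> 'b::finite \<Rightarrow> real"
  shows "(\<Sum>a\<in>UNIV. h a) = (\<Sum>i\<in>UNIV. \<Sum>k\<in>UNIV. h (i, k))"
  by (simp add: sum.cartesian_product)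

definition psd :: "('a::finite \<Rightarrow> 'a \<Rightarrow> real) \<Rightarrow> bool" where
  "psd K \<longleftrightarrow> (\<forall>c. 0 \<le> (\<Sum>a\<in>UNIV. \<Sum>b\<in>UNIV. c a * c b * K a b))"

text \<open>By the Schur product theorem these are exactly the positive semidefinite kernels. Defining them by
  their action on kernels makes closure under products immediate and avoids Gram decompositions.
  Kernels on pairs are used because the product of a kernel in the first with a kernel in the second
  component is then covered as well.\<close>

definition schur_mult :: "('n::finite \<Rightarrow> 'n \<Rightarrow> real) \<Rightarrow> bool" where
  "schur_mult S \<longleftrightarrow>
     (\<forall>L :: 'n \<times> 'n \<Rightarrow> 'n \<times> 'n \<Rightarrow> real. psd L \<longrightarrow> psd (\<lambda>a b. S (fst a) (fst b) * L a b))"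

lemma schur_multI:
  assumes "\<And>L :: 'n \<times> 'n \<Rightarrow> 'n \<times> 'n \<Rightarrow> real. psd L \<Longrightarrow> psd (\<lambda>a b. S (fst a) (fst b) * L a b)"
  shows "schur_mult (S :: 'n::finite \<Rightarrow> 'n \<Rightarrow> real)"
  using assms unfolding schur_mult_def by blast

lemma schur_multD:
  fixes L :: "'n::finite \<times> 'n \<Rightarrow> 'n \<times> 'n \<Rightarrow> real"
  assumes "schur_mult S" "psd L"
  shows "psd (\<lambda>a b. S (fst a) (fst b) * L a b)"
  using assms unfolding schur_mult_def by blast

lemma psd_add: "psd K \<Longrightarrow> psd L \<Longrightarrow> psd (\<lambda>a b. K a b + L a b)"
  by (simp add: psd_def distrib_left sum.distrib)

lemma psd_scale:
  assumes "0 \<le> r" "psd K" shows "psd (\<lambda>a b. r * K a b)"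
proof -
  have "(\<Sum>a\<in>UNIV. \<Sum>b\<in>UNIV. c a * c b * (r * K a b))
      = r * (\<Sum>a\<in>UNIV. \<Sum>b\<in>UNIV. c a * c b * K a b)" for c
    by (simp add: sum_distrib_left mult_ac)
  then show ?thesis using assms by (simp add: psd_def)
qed

lemma psd_limit:
  assumes K: "\<And>k. psd (K k)" and lim: "\<And>a b. (\<lambda>k. K k a b) \<longlonglongrightarrow> L a b"
  shows "psd L"
  unfolding psd_def
proof
  fix c
  have "(\<lambda>k. \<Sum>a\<in>UNIV. \<Sum>b\<in>UNIV. c a * c b * K k a b)
      \<longlonglongrightarrow> (\<Sum>a\<in>UNIV. \<Sum>b\<in>UNIV. c a * c b * L a b)"
    by (intro tendsto_intros lim)
  then show "0 \<le> (\<Sum>a\<in>UNIV. \<Sum>b\<in>UNIV. c a * c b * L a b)"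
    by (rule LIMSEQ_le_const) (use K in \<open>auto simp: psd_def\<close>)
qed

lemma schur_mult_add: "schur_mult S \<Longrightarrow> schur_mult T \<Longrightarrow> schur_mult (\<lambda>i j. S i j + T i j)"
  by (intro schur_multI) (simp add: distrib_right psd_add schur_multD)

lemma schur_mult_scale: "0 \<le> r \<Longrightarrow> schur_mult S \<Longrightarrow> schur_mult (\<lambda>i j. r * S i j)"
  by (intro schur_multI) (simp add: mult.assoc psd_scale schur_multD)

lemma schur_mult_mult: "schur_mult S \<Longrightarrow> schur_mult T \<Longrightarrow> schur_mult (\<lambda>i j. S i j * T i j)"
proof (intro schur_multI)
  fix L :: "'a \<times> 'a \<Rightarrow> 'a \<times> 'a \<Rightarrow> real"
  assume ST: "schur_mult S" "schur_mult T" and "psd L"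
  then have "psd (\<lambda>a b. T (fst a) (fst b) * L a b)" by (intro schur_multD)
  from schur_multD[OF ST(1) this] show "psd (\<lambda>a b. S (fst a) (fst b) * T (fst a) (fst b) * L a b)"
    by (simp add: mult.assoc)
qed

lemma schur_mult_limit:
  assumes "\<And>k. schur_mult (S k)" and "\<And>i j. (\<lambda>k. S k i j) \<longlonglongrightarrow> T i j"
  shows "schur_mult T"
proof (intro schur_multI)
  fix L :: "'a \<times> 'a \<Rightarrow> 'a \<times> 'a \<Rightarrow> real" assume "psd L"
  then have "psd (\<lambda>a b. S k (fst a) (fst b) * L a b)" for k
    using assms(1) by (rule schur_multD[rotated])
  then show "psd (\<lambda>a b. T (fst a) (fst b) * L a b)"
    by (rule psd_limit[where K = "\<lambda>k a b. S k (fst a) (fst b) * L a b"])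
      (intro tendsto_mult assms(2) tendsto_const)
qed

lemma schur_mult_rank_one: "schur_mult (\<lambda>i j. v i * v j)"
  unfolding schur_mult_def psd_def
proof (intro allI impI)
  fix L :: "'a \<times> 'a \<Rightarrow> 'a \<times> 'a \<Rightarrow> real" and c
  assume L: "\<forall>c. 0 \<le> (\<Sum>a\<in>UNIV. \<Sum>b\<in>UNIV. c a * c b * L a b)"
  show "0 \<le> (\<Sum>a\<in>UNIV. \<Sum>b\<in>UNIV. c a * c b * (v (fst a) * v (fst b) * L a b))"
    using L[rule_format, of "\<lambda>a. c a * v (fst a)"] by (simp add: mult_ac)
qed

lemma schur_mult_one: "schur_mult (\<lambda>i j. 1)"
  using schur_mult_rank_one[of "\<lambda>_. 1"] by simp

lemma schur_mult_zero: "schur_mult (\<lambda>i j. 0)"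
  using schur_mult_rank_one[of "\<lambda>_. 0"] by simp

lemma schur_mult_sum:
  "(\<And>l. l \<in> A \<Longrightarrow> schur_mult (S l)) \<Longrightarrow> schur_mult (\<lambda>i j. \<Sum>l\<in>A. S l i j)"
  by (induction A rule: infinite_finite_induct) (auto intro: schur_mult_zero schur_mult_add)

lemma schur_mult_power: "schur_mult S \<Longrightarrow> schur_mult (\<lambda>i j. S i j ^ m)"
  by (induction m) (auto intro: schur_mult_one schur_mult_mult)

lemma schur_mult_exp:
  assumes "schur_mult S" shows "schur_mult (\<lambda>i j. exp (S i j))"
proof (rule schur_mult_limit)
  show "schur_mult (\<lambda>i j. \<Sum>m<k. inverse (fact m) * S i j ^ m)" for k
    by (intro schur_mult_sum schur_mult_scale schur_mult_power assms) auto
  show "(\<lambda>k. \<Sum>m<k. inverse (fact m) * S i j ^ m) \<longlonglongrightarrow> exp (S i j)" for i j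
    using exp_converges[of "S i j"] by (simp add: sums_def)
qed


text \<open>Kernels of negative type are usually those with \<open>\<Sum> c i * c j * f i j \<le> 0\<close>
  for all \<open>c\<close> of sum zero. Here a certificate is used instead: up to additive
  constants and up to limits, \<open>-f\<close> is positive semidefinite. The constants may diverge
  along the sequence, as they do for Euclidean distances.\<close>

definition neg_type :: "('n::finite \<Rightarrow> 'n \<Rightarrow> real) \<Rightarrow> bool" where
  "neg_type f \<longleftrightarrow>
     (\<exists>c F. (\<forall>k::nat. schur_mult (\<lambda>i j. c k - F k i j)) \<and> (\<forall>i j. (\<lambda>k. F k i j) \<longlonglongrightarrow> f i j))"

text \<open>The multiplier acts on the constant kernel 1; a test vector on single indices becomes one on pairs
  by spreading each value evenly over the second component.\<close>

lemma schur_mult_imp_psd: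
  fixes S :: "'n::finite \<Rightarrow> 'n \<Rightarrow> real"
  assumes "schur_mult S" shows "psd S"
  unfolding psd_def
proof
  fix c :: "'n \<Rightarrow> real"
  have "psd (\<lambda>(a::'n\<times>'n) b. 1)"
    unfolding psd_def by (auto simp flip: sum_product)
  then have "psd (\<lambda>(a::'n\<times>'n) b. S (fst a) (fst b) * 1)"
    by (rule schur_multD[OF assms])
  then have "0 \<le> (\<Sum>a\<in>UNIV. \<Sum>b\<in>UNIV. d a * d b * S (fst a) (fst b))" for d :: "'n \<times> 'n \<Rightarrow> real"
    unfolding psd_def mult_1_right by (rule spec)
  from this[of "\<lambda>a. c (fst a) / CARD('n)"]
  have "0 \<le> (\<Sum>a\<in>UNIV. \<Sum>b\<in>UNIV. c (fst (a::'n\<times>'n)) / CARD('n) * (c (fst (b::'n\<times>'n)) / CARD('n)) * S (fst a) (fst b))" .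
  also have "\<dots> = (\<Sum>i\<in>UNIV. \<Sum>j\<in>UNIV. c i * c j * S i j)"
    unfolding sum_UNIV_prod
    by (simp add: sum_divide_distrib[symmetric])
  finally show "0 \<le> (\<Sum>i\<in>UNIV. \<Sum>j\<in>UNIV. c i * c j * S i j)" .
qed

lemma schur_mult_tensor:
  fixes S T :: "'n::finite \<Rightarrow> 'n \<Rightarrow> real"
  assumes "schur_mult S" "schur_mult T"
  shows "0 \<le> (\<Sum>i\<in>UNIV. \<Sum>k\<in>UNIV. \<Sum>j\<in>UNIV. \<Sum>l\<in>UNIV. Z i k * Z j l * (S i j * T k l))"
proof -
  have "psd (\<lambda>(a::'n\<times>'n) b. T (snd a) (snd b))"
    unfolding psd_def
  proof
    fix c :: "'n \<times> 'n \<Rightarrow> real"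
    have "(\<Sum>a\<in>UNIV. \<Sum>b\<in>UNIV. c a * c b * T (snd a) (snd b))
        = (\<Sum>i\<in>UNIV. \<Sum>k\<in>UNIV. \<Sum>j\<in>UNIV. \<Sum>l\<in>UNIV. c (i,k) * c (j,l) * T k l)"
      unfolding sum_UNIV_prod by simp
    also have "\<dots> = (\<Sum>k\<in>UNIV. \<Sum>i\<in>UNIV. \<Sum>l\<in>UNIV. \<Sum>j\<in>UNIV. c (i,k) * c (j,l) * T k l)"
      by (subst sum.swap) (intro sum.cong refl sum.swap)
    also have "\<dots> = (\<Sum>k\<in>UNIV. \<Sum>l\<in>UNIV. \<Sum>i\<in>UNIV. \<Sum>j\<in>UNIV. c (i,k) * c (j,l) * T k l)"
      by (intro sum.cong refl sum.swap)
    also have "\<dots> = (\<Sum>k\<in>UNIV. \<Sum>l\<in>UNIV. (\<Sum>i\<in>UNIV. c (i,k)) * (\<Sum>j\<in>UNIV. c (j,l)) * T k l)"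
      unfolding sum_product by (simp add: sum_distrib_right)
    also have "\<dots> \<ge> 0"
      using schur_mult_imp_psd[OF assms(2)] by (auto simp: psd_def)
    finally show "0 \<le> (\<Sum>a\<in>UNIV. \<Sum>b\<in>UNIV. c a * c b * T (snd a) (snd b))" .
  qed
  then have "psd (\<lambda>(a::'n\<times>'n) b. S (fst a) (fst b) * T (snd a) (snd b))"
    by (rule schur_multD[OF assms(1)])
  then have "0 \<le> (\<Sum>a\<in>UNIV. \<Sum>b\<in>UNIV. case_prod Z a * case_prod Z b * (S (fst a) (fst b) * T (snd a) (snd b)))"
    unfolding psd_def by (rule spec)
  then show ?thesis
    unfolding sum_UNIV_prod by simp
qed

text \<open>For the approximating kernels, expand the nonnegative form of \<open>c - F\<close> and
  \<open>d - G\<close>: every term with a constant factor is killed by the zero margins of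
  \<open>Z\<close>. Only the \<open>F\<close>-\<open>G\<close> term survives, and it passes to the limit.\<close>

lemma neg_type_tensor:
  fixes f g Z :: "'n::finite \<Rightarrow> 'n \<Rightarrow> real"
  assumes f: "neg_type f" and g: "neg_type g"
    and row: "\<And>i. (\<Sum>k\<in>UNIV. Z i k) = 0" and col: "\<And>k. (\<Sum>i\<in>UNIV. Z i k) = 0"
  shows "0 \<le> (\<Sum>i\<in>UNIV. \<Sum>k\<in>UNIV. \<Sum>j\<in>UNIV. \<Sum>l\<in>UNIV. Z i k * Z j l * (f i j * g k l))"
proof -
  let ?Q = "\<lambda>f g. \<Sum>i\<in>UNIV. \<Sum>k\<in>UNIV. \<Sum>j\<in>UNIV. \<Sum>l\<in>UNIV. Z i k * Z j l * (f i j * g k l)"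
  obtain c F where F: "\<And>k::nat. schur_mult (\<lambda>i j. c k - F k i j)"
    "\<And>i j. (\<lambda>k. F k i j) \<longlonglongrightarrow> f i j" using f unfolding neg_type_def by blast
  obtain d G where G: "\<And>k::nat. schur_mult (\<lambda>i j. d k - G k i j)"
    "\<And>i j. (\<lambda>k. G k i j) \<longlonglongrightarrow> g i j" using g unfolding neg_type_def by blast
  have colZ: "(\<Sum>i\<in>UNIV. \<Sum>k\<in>UNIV. Z i k * h k) = 0" for h
    by (subst sum.swap) (simp add: sum_distrib_right[symmetric] col)
  have rowZ: "(\<Sum>i\<in>UNIV. \<Sum>k\<in>UNIV. Z i k * h i) = 0" for h
    by (simp add: sum_distrib_right[symmetric] row)
  have killf: "?Q (\<lambda>i j. r) g = 0" for r and g :: "'n \<Rightarrow> 'n \<Rightarrow> real"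
  proof -
    have "?Q (\<lambda>i j. r) g = (\<Sum>i\<in>UNIV. \<Sum>k\<in>UNIV. Z i k * (\<Sum>j\<in>UNIV. \<Sum>l\<in>UNIV. Z j l * (r * g k l)))"
      by (simp add: sum_distrib_left mult.assoc)
    also have "\<dots> = 0" by (rule colZ)
    finally show ?thesis .
  qed
  have killg: "?Q f (\<lambda>i j. r) = 0" for r and f :: "'n \<Rightarrow> 'n \<Rightarrow> real"
  proof -
    have "?Q f (\<lambda>i j. r) = (\<Sum>i\<in>UNIV. \<Sum>k\<in>UNIV. Z i k * (\<Sum>j\<in>UNIV. \<Sum>l\<in>UNIV. Z j l * (f i j * r)))"
      by (simp add: sum_distrib_left mult.assoc)
    also have "\<dots> = 0" by (rule rowZ)
    finally show ?thesis .
  qed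
  have "0 \<le> ?Q (F m) (G m)" for m
  proof -
    have "0 \<le> ?Q (\<lambda>i j. c m - F m i j) (\<lambda>i j. d m - G m i j)"
      by (rule schur_mult_tensor) (rule F G)+
    also have "\<dots> = ?Q (\<lambda>i j. c m) (\<lambda>i j. d m - G m i j) - ?Q (F m) (\<lambda>i j. d m - G m i j)"
      by (simp add: left_diff_distrib right_diff_distrib sum_subtractf)
    also have "\<dots> = - (?Q (F m) (\<lambda>i j. d m) - ?Q (F m) (G m))"
      unfolding killf by (simp add: right_diff_distrib sum_subtractf)
    finally show ?thesis unfolding killg by simp
  qed
  moreover have "(\<lambda>m. ?Q (F m) (G m)) \<longlonglongrightarrow> ?Q f g"
    by (intro tendsto_intros F G)
  ultimately show ?thesis by (intro LIMSEQ_le_const) auto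
qed

section \<open>Euclidean distances are of negative type\<close>

text \<open>The iterates are polynomials in \<open>x\<close> with nonnegative coefficients, so they map Schur
  multipliers to Schur multipliers; their limit is the fixed point \<open>1 - sqrt (1 - x)\<close>.\<close>

primrec sqrt_iter :: "real \<Rightarrow> nat \<Rightarrow> real" where
  "sqrt_iter x 0 = 0"
| "sqrt_iter x (Suc k) = 1/2 * (x + sqrt_iter x k * sqrt_iter x k)"

lemma sqrt_iter_bounds:
  assumes "0 \<le> x" "x \<le> 1" shows "0 \<le> sqrt_iter x k" "sqrt_iter x k \<le> 1"
proof -
  have "0 \<le> sqrt_iter x k \<and> sqrt_iter x k \<le> 1"
    by (induction k) (use assms in \<open>auto simp: mult_le_one add_mono\<close>, smt (verit) mult_le_one)
  then show "0 \<le> sqrt_iter x k" "sqrt_iter x k \<le> 1" by auto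
qed

lemma sqrt_iter_limit:
  assumes x: "0 \<le> x" "x \<le> 1" shows "sqrt_iter x \<longlonglongrightarrow> 1 - sqrt (1 - x)"
proof -
  have mono: "sqrt_iter x k \<le> sqrt_iter x (Suc k)" for k
  proof (induction k)
    case (Suc k)
    have "sqrt_iter x k * sqrt_iter x k \<le> sqrt_iter x (Suc k) * sqrt_iter x (Suc k)"
      by (rule mult_mono'[OF Suc Suc]) (use sqrt_iter_bounds[OF x] in auto)
    then show ?case by simp
  qed (use x in simp)
  then have "incseq (sqrt_iter x)" by (rule incseq_SucI)
  moreover have "\<forall>k. sqrt_iter x k \<le> 1" using sqrt_iter_bounds[OF x] by auto
  ultimately obtain l where l: "sqrt_iter x \<longlonglongrightarrow> l"
    by (rule incseq_convergent)
  have "(\<lambda>k. sqrt_iter x (Suc k)) \<longlonglongrightarrow> 1/2 * (x + l * l)"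
    unfolding sqrt_iter.simps by (intro tendsto_intros l)
  then have "l = 1/2 * (x + l * l)"
    using LIMSEQ_Suc[OF l] LIMSEQ_unique by blast
  then have "(1 - l)\<^sup>2 = 1 - x" by (simp add: power2_eq_square algebra_simps)
  moreover have "l \<le> 1"
    using l by (rule LIMSEQ_le_const2) (use sqrt_iter_bounds[OF x] in auto)
  ultimately have "l = 1 - sqrt (1 - x)"
    by (smt (verit) real_sqrt_unique)
  then show ?thesis using l by simp
qed

lemma schur_mult_sqrt:
  assumes S: "schur_mult S" and bd: "\<And>i j. 0 \<le> S i j" "\<And>i j. S i j \<le> 1"
  shows "schur_mult (\<lambda>i j. 1 - sqrt (1 - S i j))"
proof (rule schur_mult_limit)
  show "schur_mult (\<lambda>i j. sqrt_iter (S i j) k)" for k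
  proof (induction k)
    case (Suc k)
    show ?case unfolding sqrt_iter.simps
      by (intro schur_mult_scale schur_mult_add schur_mult_mult S Suc) auto
  qed (simp add: schur_mult_zero)
  show "(\<lambda>k. sqrt_iter (S i j) k) \<longlonglongrightarrow> 1 - sqrt (1 - S i j)" for i j
    by (rule sqrt_iter_limit) (rule bd)+
qed

text \<open>Schoenberg's theorem. With \<open>N\<close> the squared distances, the Gaussian kernel
  \<open>E = exp (- s N)\<close> is positive semidefinite, because \<open>N\<close> is a sum of functions of
  one index minus twice a Gram kernel. Then \<open>1 - sqrt (1 - E)\<close> is a Schur multiplier, and
  \<open>sqrt ((1 - E) / s)\<close> tends to \<open>sqrt N\<close> as \<open>s\<close> tends to 0.\<close>

lemma neg_type_euclidean:
  fixes y :: "'n::finite \<Rightarrow> nat \<Rightarrow> real"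
  shows "neg_type (\<lambda>i j. L2_set (\<lambda>l. y i l - y j l) {..<k})"
proof -
  define N where "N i j = (\<Sum>l<k. (y i l - y j l)\<^sup>2)" for i j
  define a where "a i = (\<Sum>l<k. (y i l)\<^sup>2)" for i
  define p where "p i j = (\<Sum>l<k. y i l * y j l)" for i j
  define s where "s m = 1 / (real m + 1)" for m
  have s: "0 < s m" for m by (simp add: s_def)
  have N0: "0 \<le> N i j" for i j by (simp add: N_def sum_nonneg)
  have N: "N i j = a i + a j - 2 * p i j" for i j
    unfolding N_def a_def p_def
    by (simp add: power2_diff sum.distrib sum_subtractf sum_distrib_left mult.assoc)
  define E where "E m i j = exp (- (s m * N i j))" for m i j
  have "schur_mult (E m)" for m
  proof -
    have "schur_mult p"
      unfolding p_def by (intro schur_mult_sum schur_mult_rank_one)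
    then have "schur_mult (\<lambda>i j. exp (- s m * a i) * exp (- s m * a j) * exp (2 * s m * p i j))"
      using s by (intro schur_mult_mult[OF schur_mult_rank_one] schur_mult_exp schur_mult_scale)
        (simp add: less_imp_le)
    also have "(\<lambda>i j. exp (- s m * a i) * exp (- s m * a j) * exp (2 * s m * p i j)) = E m"
      by (simp add: fun_eq_iff E_def N flip: exp_add) (simp add: algebra_simps)
    finally show ?thesis .
  qed
  then have "schur_mult (\<lambda>i j. 1 - sqrt (1 - E m i j))" for m
    by (rule schur_mult_sqrt) (use N0 s in \<open>auto simp: E_def less_imp_le\<close>)
  then have *: "schur_mult (\<lambda>i j. 1 / sqrt (s m) * (1 - sqrt (1 - E m i j)))" for m
    using s by (intro schur_mult_scale) (auto simp: less_imp_le)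
  have "schur_mult (\<lambda>i j. 1 / sqrt (s m) - sqrt ((1 - E m i j) / s m))" for m
    using *[of m] by (simp add: right_diff_distrib real_sqrt_divide)
  moreover have "(\<lambda>m. sqrt ((1 - E m i j) / s m)) \<longlonglongrightarrow> L2_set (\<lambda>l. y i l - y j l) {..<k}" for i j
  proof -
    have "(\<lambda>m. (1 - E m i j) / s m) \<longlonglongrightarrow> N i j"
      unfolding E_def s_def by real_asymp
    then show ?thesis unfolding L2_set_def N_def[symmetric] by (rule tendsto_real_sqrt)
  qed
  ultimately show ?thesis
    unfolding neg_type_def
    by (intro exI[of _ "\<lambda>m. 1 / sqrt (s m)"] exI[of _ "\<lambda>m i j. sqrt ((1 - E m i j) / s m)"]) auto
qed

section \<open>Four-point metrics are of negative type\<close>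

definition splits :: "nat set \<Rightarrow> nat \<Rightarrow> nat \<Rightarrow> real" where
  "splits A a b = (if a \<in> A \<longleftrightarrow> b \<in> A then 0 else 1)"

text \<open>A four-point metric is realised in the plane with the \<open>l\<^sub>1\<close>-norm by a box with a leg
  at each corner. The points \<open>0\<close>, \<open>2\<close> and \<open>1\<close>, \<open>3\<close> are
  opposite when the sum of their distances is the largest of the three pairings. The weights of the
  singletons are the lengths of the legs, those of the two-element sets the lengths of the sides;
  the former are nonnegative by the triangle inequality, the latter by maximality.\<close>

lemma four_point_cuts:
  fixes d :: "nat \<Rightarrow> nat \<Rightarrow> real"
  assumes zero: "\<And>a. d a a = 0" and sym: "\<And>a b. d a b = d b a"
    and tri: "\<And>a b c. d a b \<le> d a c + d c b"
    and max: "d 0 1 + d 2 3 \<le> d 0 2 + d 1 3" "d 0 3 + d 1 2 \<le> d 0 2 + d 1 3"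
  shows "\<exists>ws. (\<forall>(w, A)\<in>set ws. 0 \<le> w) \<and>
    (\<forall>a<4. \<forall>b<4. d a b = (\<Sum>(w, A)\<leftarrow>ws. w * splits A a b))"
proof -
  define ws where "ws =
     [((d 0 1 + d 0 3 - d 1 3) / 2, {0}), ((d 0 1 + d 1 2 - d 0 2) / 2, {1}),
      ((d 1 2 + d 2 3 - d 1 3) / 2, {2}), ((d 0 3 + d 2 3 - d 0 2) / 2, {3}),
      ((d 0 2 + d 1 3 - d 0 1 - d 2 3) / 2, {0, 1}),
      ((d 0 2 + d 1 3 - d 0 3 - d 1 2) / 2, {0, 3 :: nat})]"
  have "\<forall>(w, A)\<in>set ws. 0 \<le> w"
    using max tri[of 1 3 0] tri[of 0 2 1] tri[of 1 3 2] tri[of 0 2 3]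
    unfolding ws_def by (simp add: sym[of 3 0] sym[of 1 0] sym[of 2 1] sym[of 3 2] del: One_nat_def)
  moreover have "d a b = (\<Sum>(w, A)\<leftarrow>ws. w * splits A a b)" if "a < 4" "b < 4" for a b
  proof -
    have "a = 0 \<or> a = 1 \<or> a = 2 \<or> a = 3" "b = 0 \<or> b = 1 \<or> b = 2 \<or> b = 3"
      using that by auto
    then show ?thesis
      unfolding ws_def
      by (elim disjE) (simp_all add: splits_def field_simps zero sym[of 1 0] sym[of 2 0] sym[of 3 0]
          sym[of 2 1] sym[of 3 1] sym[of 3 2] del: One_nat_def)
  qed
  ultimately show ?thesis by blast
qed

text \<open>With signs \<open>e = 1\<close> on \<open>A\<close> and \<open>e = -1\<close> off it, the cut
  pseudo-metric is \<open>(1 - e i * e j) / 2\<close>.\<close>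

lemma schur_mult_split: "schur_mult (\<lambda>i j. 1/2 - splits A (p i) (p j))"
proof -
  define e where "e i = (if p i \<in> A then 1 else -1 :: real)" for i
  have "schur_mult (\<lambda>i j. 1/2 * (e i * e j))"
    by (intro schur_mult_scale schur_mult_rank_one) simp
  also have "(\<lambda>i j. 1/2 * (e i * e j)) = (\<lambda>i j. 1/2 - splits A (p i) (p j))"
    by (auto simp: fun_eq_iff e_def splits_def)
  finally show ?thesis .
qed

lemma neg_type_cuts:
  fixes p :: "'n::finite \<Rightarrow> nat"
  assumes "\<forall>(w, A)\<in>set ws. 0 \<le> w"
  shows "neg_type (\<lambda>i j. \<Sum>(w, A)\<leftarrow>ws. w * splits A (p i) (p j))"
proof -
  have "schur_mult (\<lambda>i j. (\<Sum>(w, A)\<leftarrow>ws. w / 2) - (\<Sum>(w, A)\<leftarrow>ws. w * splits A (p i) (p j)))"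
    using assms
  proof (induction ws)
    case Nil
    show ?case by (simp add: schur_mult_zero)
  next
    case (Cons c ws)
    obtain w A where c: "c = (w, A)" by force
    have "schur_mult (\<lambda>i j. w * (1/2 - splits A (p i) (p j)) +
        ((\<Sum>(w, A)\<leftarrow>ws. w / 2) - (\<Sum>(w, A)\<leftarrow>ws. w * splits A (p i) (p j))))"
      using Cons c by (intro schur_mult_add schur_mult_scale schur_mult_split Cons.IH) auto
    then show ?case by (simp add: c algebra_simps)
  qed
  then show ?thesis
    unfolding neg_type_def
    by (intro exI[of _ "\<lambda>_. \<Sum>(w, A)\<leftarrow>ws. w / 2"]
        exI[of _ "\<lambda>_ i j. \<Sum>(w, A)\<leftarrow>ws. w * splits A (p i) (p j)"]) auto
qed

text \<open>Fewer than four points are handled by letting some labels denote the same point. Of the three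
  pairings of the labels, the one with the largest sum is moved to the position that
  \<open>four_point_cuts\<close> requires, by swapping two labels.\<close>

lemma four_point_labelling:
  fixes f :: "'n::finite \<Rightarrow> 'n \<Rightarrow> real"
  assumes card: "CARD('n) \<le> 4"
    and zero: "\<And>a. f a a = 0" and sym: "\<And>a b. f a b = f b a"
    and tri: "\<And>a b c. f a b \<le> f a c + f c b"
  obtains p :: "'n \<Rightarrow> nat" and q :: "nat \<Rightarrow> 'n" where "\<And>i. p i < 4" "\<And>i. q (p i) = i"
    "f (q 0) (q 1) + f (q 2) (q 3) \<le> f (q 0) (q 2) + f (q 1) (q 3)"
    "f (q 0) (q 3) + f (q 1) (q 2) \<le> f (q 0) (q 2) + f (q 1) (q 3)"
proof (goal_cases)
  case goal: 1
  obtain p :: "'n \<Rightarrow> nat" where p: "inj p" "range p \<subseteq> {..<4}"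
    using card_le_inj[of "UNIV :: 'n set" "{..<4::nat}"] card by auto
  define q where "q = inv p"
  have q: "q (p i) = i" for i using p(1) by (simp add: q_def)
  have p4: "p i < 4" for i using p(2) by auto
  define s where "s a b c d = f (q a) (q b) + f (q c) (q d)" for a b c d
  note sym4 = sym[of "q 1" "q 0"] sym[of "q 2" "q 0"] sym[of "q 3" "q 0"]
    sym[of "q 2" "q 1"] sym[of "q 3" "q 1"] sym[of "q 3" "q 2"]
  have perm: thesis if "\<And>a. a < 4 \<Longrightarrow> t (t a) = a \<and> t a < 4"
    "s (t 0) (t 1) (t 2) (t 3) \<le> s (t 0) (t 2) (t 1) (t 3)"
    "s (t 0) (t 3) (t 1) (t 2) \<le> s (t 0) (t 2) (t 1) (t 3)" for t :: "nat \<Rightarrow> nat"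
    by (rule goal[of "\<lambda>i. t (p i)" "\<lambda>a. q (t a)"]) (use that p4 q in \<open>auto simp: s_def\<close>)
  consider "s 0 1 2 3 \<le> s 0 2 1 3" "s 0 3 1 2 \<le> s 0 2 1 3"
    | "s 0 2 1 3 \<le> s 0 1 2 3" "s 0 3 1 2 \<le> s 0 1 2 3"
    | "s 0 1 2 3 \<le> s 0 3 1 2" "s 0 2 1 3 \<le> s 0 3 1 2" by linarith
  then show thesis
  proof cases
    case 1
    then show thesis by (intro perm[of "\<lambda>a. a"]) auto
  next
    case 2
    then show thesis
      by (intro perm[of "\<lambda>a. if a = 1 then 2 else if a = 2 then 1 else a"])
        (auto simp: s_def sym4 add_ac simp del: One_nat_def)
  next
    case 3
    then show thesis
      by (intro perm[of "\<lambda>a. if a = 3 then 2 else if a = 2 then 3 else a"])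
        (auto simp: s_def sym4 add_ac simp del: One_nat_def)
  qed
qed

lemma neg_type_four_points:
  fixes f :: "'n::finite \<Rightarrow> 'n \<Rightarrow> real"
  assumes card: "CARD('n) \<le> 4"
    and zero: "\<And>a. f a a = 0" and sym: "\<And>a b. f a b = f b a"
    and tri: "\<And>a b c. f a b \<le> f a c + f c b"
  shows "neg_type f"
proof -
  obtain p :: "'n \<Rightarrow> nat" and q :: "nat \<Rightarrow> 'n" where p: "\<And>i. p i < 4" and q: "\<And>i. q (p i) = i"
    and max: "f (q 0) (q 1) + f (q 2) (q 3) \<le> f (q 0) (q 2) + f (q 1) (q 3)"
      "f (q 0) (q 3) + f (q 1) (q 2) \<le> f (q 0) (q 2) + f (q 1) (q 3)"
    using four_point_labelling[where f = f, OF assms] by blast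
  obtain ws where ws: "\<forall>(w, A)\<in>set ws. 0 \<le> w"
    and d: "\<And>a b. a < 4 \<Longrightarrow> b < 4 \<Longrightarrow> f (q a) (q b) = (\<Sum>(w, A)\<leftarrow>ws. w * splits A a b)"
    using four_point_cuts[of "\<lambda>a b. f (q a) (q b)", OF zero sym tri max] by blast
  have "f = (\<lambda>i j. \<Sum>(w, A)\<leftarrow>ws. w * splits A (p i) (p j))"
    using d[OF p p] by (simp add: q fun_eq_iff)
  with neg_type_cuts[OF ws, of p] show ?thesis by simp
qed

section \<open>Quadratic forms on doubly stochastic matrices\<close>

definition doubly_stochastic :: "('n::finite \<Rightarrow> 'n \<Rightarrow> real) \<Rightarrow> bool" where
  "doubly_stochastic P \<longleftrightarrow>
     (\<forall>i k. 0 \<le> P i k) \<and> (\<forall>i. (\<Sum>k\<in>UNIV. P i k) = 1) \<and> (\<forall>k. (\<Sum>i\<in>UNIV. P i k) = 1)"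

definition overlap :: "('n::finite \<Rightarrow> 'n \<Rightarrow> real) \<Rightarrow> ('n \<Rightarrow> 'n \<Rightarrow> real) \<Rightarrow>
    ('n \<Rightarrow> 'n \<Rightarrow> real) \<Rightarrow> ('n \<Rightarrow> 'n \<Rightarrow> real) \<Rightarrow> real" where
  "overlap f g P Q =
     (\<Sum>i\<in>UNIV. \<Sum>k\<in>UNIV. \<Sum>j\<in>UNIV. \<Sum>l\<in>UNIV. P i k * Q j l * (f i j * g k l))"

lemma fraction_not_alone:
  fixes p :: "'n::finite \<Rightarrow> real"
  assumes nonneg: "\<And>x. 0 \<le> p x" and sum: "(\<Sum>x\<in>UNIV. p x) = 1" and x: "0 < p x" "p x < 1"
  shows "\<exists>y. y \<noteq> x \<and> 0 < p y \<and> p y < 1"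
proof -
  have split: "(\<Sum>y\<in>UNIV - {x}. p y) = 1 - p x"
    using sum by (simp add: sum.remove[of UNIV x])
  then have "\<exists>y\<in>UNIV - {x}. p y \<noteq> 0"
    using x by (metis (no_types, lifting) diff_gt_0_iff_gt order_less_irrefl sum.neutral)
  then obtain y where y: "y \<noteq> x" "p y \<noteq> 0" by blast
  moreover have "p y \<le> (\<Sum>y\<in>UNIV - {x}. p y)"
    by (rule member_le_sum) (use y nonneg in auto)
  ultimately show ?thesis
    using nonneg[of y] split x by (intro exI[of _ y]) auto
qed

text \<open>Walk from one fractional entry to another one in the same row, then to another one in the same
  column, and so on. As soon as a column recurs, the steps since its first visit form a closed
  alternating walk: with weights \<open>1\<close> and \<open>-1\<close> along it, all margins vanish.
  The result is nonzero since the columns inside the closed walk are distinct.\<close>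

lemma fractional_circulation:
  fixes P :: "'n::finite \<Rightarrow> 'n \<Rightarrow> real"
  assumes P: "doubly_stochastic P" and frac: "0 < P i0 k0" "P i0 k0 < 1"
  obtains Z where "\<And>i. (\<Sum>k\<in>UNIV. Z i k) = 0" "\<And>k. (\<Sum>i\<in>UNIV. Z i k) = 0"
    "\<And>i k. P i k = 0 \<Longrightarrow> Z i k = 0" "Z \<noteq> (\<lambda>i k. 0 :: real)"
proof -
  define F where "F i k \<longleftrightarrow> 0 < P i k \<and> P i k < 1" for i k
  have row: "\<exists>k'. k' \<noteq> k \<and> F i k'" if "F i k" for i k
    using fraction_not_alone[of "P i"] P that unfolding F_def doubly_stochastic_def by blast
  have col: "\<exists>i'. i' \<noteq> i \<and> F i' k" if "F i k" for i k
    using fraction_not_alone[of "\<lambda>i. P i k"] P that unfolding F_def doubly_stochastic_def by blast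
  have "\<exists>s :: nat \<Rightarrow> 'n \<times> 'n. \<forall>t. F (fst (s t)) (snd (s t)) \<and>
      (F (fst (s t)) (snd (s (Suc t))) \<and> fst (s (Suc t)) \<noteq> fst (s t) \<and> snd (s (Suc t)) \<noteq> snd (s t))"
  proof (rule dependent_nat_choice)
    show "\<exists>x. F (fst x) (snd x)" using frac by (intro exI[of _ "(i0, k0)"]) (simp add: F_def)
    fix x :: "'n \<times> 'n" and t :: nat
    assume "F (fst x) (snd x)"
    then obtain k' where k': "k' \<noteq> snd x" "F (fst x) k'" using row by blast
    then obtain i' where "i' \<noteq> fst x" "F i' k'" using col by blast
    with k' show "\<exists>y. F (fst y) (snd y) \<and> F (fst x) (snd y) \<and> fst y \<noteq> fst x \<and> snd y \<noteq> snd x"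
      by (intro exI[of _ "(i', k')"]) auto
  qed
  then obtain s :: "nat \<Rightarrow> 'n \<times> 'n" where s: "\<And>t. F (fst (s t)) (snd (s t))"
    "\<And>t. F (fst (s t)) (snd (s (Suc t)))" "\<And>t. fst (s (Suc t)) \<noteq> fst (s t)"
    "\<And>t. snd (s (Suc t)) \<noteq> snd (s t)" by blast
  have "\<not> inj (\<lambda>t. snd (s t))"
    using finite_imageD[of "\<lambda>t. snd (s t)" UNIV] by auto
  then have ex: "\<exists>n. \<exists>m<n. snd (s m) = snd (s n)"
    unfolding inj_on_def by (metis linorder_neqE_nat)
  \<comment> \<open>The first recurrence of a column: the columns before it are pairwise distinct.\<close>
  define n where "n = (LEAST n. \<exists>m<n. snd (s m) = snd (s n))"
  obtain m where m: "m < n" "snd (s m) = snd (s n)"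
    using LeastI_ex[OF ex] unfolding n_def by blast
  have first: "snd (s a) \<noteq> snd (s b)" if "a < b" "b < n" for a b
    using not_less_Least[of b "\<lambda>n. \<exists>m<n. snd (s m) = snd (s n)"] that unfolding n_def by blast
  define r where "r t = fst (s (m + t))" for t
  define c where "c t = snd (s (m + t))" for t
  define L where "L = n - m"
  have cL: "c L = c 0" using m by (simp add: c_def L_def)
  have "c (Suc 0) \<noteq> c 0" using s(4)[of m] by (simp add: c_def)
  with cL have L: "2 \<le> L"
    using m by (cases "L = 0"; cases "L = 1") (auto simp: L_def)
  have c_eq: "c a = c b \<longleftrightarrow> a = b" if "a < L" "b < L" for a b
    using first[of "m + a" "m + b"] first[of "m + b" "m + a"] that
    unfolding c_def L_def by (metis less_diff_conv add.commute linorder_neqE_nat nat_add_left_cancel_less)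
  define e where "e i k t = (if r t = i then of_bool (c (Suc t) = k) - of_bool (c t = k) else 0 :: real)" for i k t
  define Z where "Z i k = (\<Sum>t<L. e i k t)" for i k
  have "(\<Sum>k\<in>UNIV. Z i k) = 0" for i
  proof -
    have "(\<Sum>k\<in>UNIV. Z i k) = (\<Sum>t<L. \<Sum>k\<in>UNIV. e i k t)"
      unfolding Z_def by (rule sum.swap)
    also have "\<dots> = 0"
    proof (rule sum.neutral, rule ballI)
      fix t show "(\<Sum>k\<in>UNIV. e i k t) = 0"
        by (cases "r t = i") (simp_all add: e_def sum_subtractf of_bool_def)
    qed
    finally show ?thesis .
  qed
  moreover have "(\<Sum>i\<in>UNIV. Z i k) = 0" for k
  proof -
    have "(\<Sum>i\<in>UNIV. Z i k) = (\<Sum>t<L. \<Sum>i\<in>UNIV. e i k t)"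
      unfolding Z_def by (rule sum.swap)
    also have "\<dots> = (\<Sum>t<L. of_bool (c (Suc t) = k) - of_bool (c t = k))"
      by (simp add: e_def)
    also have "\<dots> = of_bool (c L = k) - of_bool (c 0 = k)"
      by (rule sum_lessThan_telescope)
    finally show ?thesis using cL by simp
  qed
  moreover have "Z i k = 0" if "P i k = 0" for i k
  proof -
    have "c (Suc t) \<noteq> k \<and> c t \<noteq> k" if "r t = i" for t
      using s(1,2)[of "m + t"] \<open>P i k = 0\<close> that unfolding F_def r_def c_def by force
    then show ?thesis unfolding Z_def e_def by (intro sum.neutral) auto
  qed
  moreover have "Z (r 1) (c 1) = -1"
  proof -
    have "e (r 1) (c 1) t = (if t = 1 then -1 else 0)" if t: "t < L" for t
    proof -
      have "c (Suc t) = c 1 \<longleftrightarrow> t = 0"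
      proof (cases "Suc t = L")
        case True
        then show ?thesis using cL L c_eq[of 0 1] by auto
      next
        case False
        then show ?thesis using L t c_eq[of "Suc t" 1] by auto
      qed
      moreover have "r 1 \<noteq> r 0" using s(3)[of m] by (simp add: r_def)
      ultimately show ?thesis
        using L t c_eq[of t 1] c_eq[of 0 1] unfolding e_def by auto
    qed
    then have "Z (r 1) (c 1) = (\<Sum>t<L. if t = 1 then -1 else 0)"
      unfolding Z_def by (intro sum.cong) auto
    then show ?thesis using L by simp
  qed
  then have "Z \<noteq> (\<lambda>i k. 0)" by auto
  ultimately show ?thesis by (intro that[of Z]) blast+
qed

lemma overlap_perturb:
  "overlap f g (\<lambda>i k. P i k + t * Z i k) (\<lambda>i k. P i k + t * Z i k)
   = overlap f g P P + t * (overlap f g P Z + overlap f g Z P) + t\<^sup>2 * overlap f g Z Z"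
  unfolding overlap_def sum_distrib_left sum.distrib[symmetric]
  by (intro sum.cong refl) (simp add: algebra_simps power2_eq_square)

lemma overlap_uminus:
  "overlap f g P (\<lambda>i k. - Z i k) = - overlap f g P Z"
  "overlap f g (\<lambda>i k. - Z i k) P = - overlap f g Z P"
  unfolding overlap_def by (simp_all add: sum_negf)

lemma zero_sum_has_neg:
  fixes z :: "'n::finite \<Rightarrow> real"
  assumes "(\<Sum>k\<in>UNIV. z k) = 0" "z k \<noteq> 0" shows "\<exists>k. z k < 0"
  using sum_nonneg_eq_0_iff[of UNIV z] assms by (meson UNIV_I finite not_le)

text \<open>Along a direction \<open>Z\<close> supported where \<open>P\<close> is, the form is a quadratic
  polynomial with nonnegative leading coefficient, so it does not decrease for \<open>t \<ge> 0\<close>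
  after a suitable choice of the sign of \<open>Z\<close>. The largest \<open>t\<close> that keeps all
  entries nonnegative makes one of them vanish.\<close>

lemma overlap_improve:
  fixes f g P :: "'n::finite \<Rightarrow> 'n \<Rightarrow> real"
  assumes P: "doubly_stochastic P" and frac: "0 < P i0 k0" "P i0 k0 < 1"
    and convex: "\<And>Z. \<lbrakk>\<And>i. (\<Sum>k\<in>UNIV. Z i k) = 0; \<And>k. (\<Sum>i\<in>UNIV. Z i k) = 0\<rbrakk> \<Longrightarrow> 0 \<le> overlap f g Z Z"
  obtains P' where "doubly_stochastic P'" "overlap f g P P \<le> overlap f g P' P'"
    "{(i, k). P' i k \<noteq> 0} \<subset> {(i, k). P i k \<noteq> 0}"
proof -
  obtain Y where Y: "\<And>i. (\<Sum>k\<in>UNIV. Y i k) = 0" "\<And>k. (\<Sum>i\<in>UNIV. Y i k) = 0"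
    "\<And>i k. P i k = 0 \<Longrightarrow> Y i k = 0" "Y \<noteq> (\<lambda>i k. 0 :: real)"
    using fractional_circulation[OF P frac] by metis
  define Z where "Z = (if 0 \<le> overlap f g P Y + overlap f g Y P then Y else (\<lambda>i k. - Y i k))"
  have Z: "\<And>i. (\<Sum>k\<in>UNIV. Z i k) = 0" "\<And>k. (\<Sum>i\<in>UNIV. Z i k) = 0"
    "\<And>i k. P i k = 0 \<Longrightarrow> Z i k = 0" "Z \<noteq> (\<lambda>i k. 0 :: real)"
    and lin: "0 \<le> overlap f g P Z + overlap f g Z P"
    using Y by (auto simp: Z_def sum_negf overlap_uminus fun_eq_iff)
  have quad: "0 \<le> overlap f g Z Z" by (rule convex) (rule Z)+
  define N where "N = {(i, k). Z i k < 0}"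
  have "\<exists>i k. Z i k < 0"
    using Z(4) zero_sum_has_neg[OF Z(1)] by metis
  then have N: "N \<noteq> {}" "finite N" by (auto simp: N_def)
  \<comment> \<open>The first time at which an entry of the moving matrix hits zero.\<close>
  define t where "t = Min ((\<lambda>(i, k). P i k / (- Z i k)) ` N)"
  have "t \<in> (\<lambda>(i, k). P i k / (- Z i k)) ` N"
    unfolding t_def using N by (intro Min_in) auto
  then obtain i1 k1 where ik: "Z i1 k1 < 0" "t = P i1 k1 / (- Z i1 k1)" by (auto simp: N_def)
  have P0: "0 \<le> P i k" for i k using P by (simp add: doubly_stochastic_def)
  have t0: "0 \<le> t" using ik P0 by (simp add: divide_nonneg_neg)
  define P' where "P' i k = P i k + t * Z i k" for i k
  have P'0: "0 \<le> P' i k" for i k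
  proof (cases "Z i k < 0")
    case True
    then have "t \<le> P i k / (- Z i k)"
      unfolding t_def using N by (intro Min_le) (auto simp: N_def)
    with True show ?thesis by (simp add: P'_def field_simps)
  qed (use P0 t0 in \<open>simp add: P'_def\<close>)
  have "doubly_stochastic P'"
    using P P'0 Z(1,2)
    by (simp add: doubly_stochastic_def P'_def sum.distrib sum_distrib_left[symmetric])
  moreover have "overlap f g P P \<le> overlap f g P' P'"
    unfolding P'_def overlap_perturb using t0 lin quad by simp
  moreover have "{(i, k). P' i k \<noteq> 0} \<subset> {(i, k). P i k \<noteq> 0}"
  proof -
    have "P' i1 k1 = 0" "P i1 k1 \<noteq> 0"
      using ik Z(3) by (auto simp: P'_def field_simps)
    moreover have "P' i k = 0" if "P i k = 0" for i k
      using Z(3)[OF that] that by (simp add: P'_def)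
    ultimately show ?thesis by blast
  qed
  ultimately show ?thesis by (rule that)
qed

lemma integral_doubly_stochastic:
  fixes P :: "'n::finite \<Rightarrow> 'n \<Rightarrow> real"
  assumes P: "doubly_stochastic P" and integral: "\<And>i k. P i k = 0 \<or> P i k = 1"
  obtains \<sigma> where "bij \<sigma>" "P = (\<lambda>i k. of_bool (k = \<sigma> i))"
proof -
  have one: "\<exists>!x. p x = 1"
    if sum: "(\<Sum>x\<in>UNIV. p x) = 1" and p: "\<And>x. p x = 0 \<or> p x = 1" for p :: "'n \<Rightarrow> real"
  proof -
    have "(\<Sum>x\<in>UNIV. p x) = (\<Sum>x\<in>UNIV. of_bool (p x = 1))"
      by (intro sum.cong refl) (metis p of_bool_eq(1,2) zero_neq_one)
    then have "card {x. p x = 1} = 1" using sum by simp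
    then show ?thesis by (metis (mono_tags, lifting) card_1_singletonE mem_Collect_eq singleton_iff)
  qed
  have "\<exists>!k. P i k = 1" "\<exists>!i. P i k = 1" for i k
    using P integral one[of "P i"] one[of "\<lambda>i. P i k"] by (auto simp: doubly_stochastic_def)
  then obtain \<sigma> where \<sigma>: "\<And>i k. P i k = 1 \<longleftrightarrow> k = \<sigma> i" by metis
  have "inj \<sigma>"
    by (rule injI) (metis \<sigma> \<open>\<And>k. \<exists>!i. P i k = 1\<close>)
  then have "bij \<sigma>" by (simp add: bij_def finite_UNIV_inj_surj)
  moreover have "P = (\<lambda>i k. of_bool (k = \<sigma> i))"
    using \<sigma> integral by (auto simp: fun_eq_iff of_bool_def)
  ultimately show ?thesis by (rule that)
qed

lemma overlap_le_permutation:
  fixes f g P :: "'n::finite \<Rightarrow> 'n \<Rightarrow> real"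
  assumes P: "doubly_stochastic P"
    and convex: "\<And>Z. \<lbrakk>\<And>i. (\<Sum>k\<in>UNIV. Z i k) = 0; \<And>k. (\<Sum>i\<in>UNIV. Z i k) = 0\<rbrakk> \<Longrightarrow> 0 \<le> overlap f g Z Z"
  shows "\<exists>\<sigma>. bij \<sigma> \<and> overlap f g P P \<le> (\<Sum>i\<in>UNIV. \<Sum>j\<in>UNIV. f i j * g (\<sigma> i) (\<sigma> j))"
  using P
proof (induction "card {(i, k). P i k \<noteq> 0}" arbitrary: P rule: less_induct)
  case (less P)
  have le: "P i k \<le> 1" for i k
    using member_le_sum[of k UNIV "P i"] less.prems by (auto simp: doubly_stochastic_def)
  show ?case
  proof (cases "\<exists>i k. 0 < P i k \<and> P i k < 1")
    case True
    then obtain i k where frac: "0 < P i k" "P i k < 1" by blast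
    obtain P' where P': "doubly_stochastic P'" "overlap f g P P \<le> overlap f g P' P'"
      "{(i, k). P' i k \<noteq> 0} \<subset> {(i, k). P i k \<noteq> 0}"
      by (rule overlap_improve[OF less.prems frac convex])
    from P'(3) have "card {(i, k). P' i k \<noteq> 0} < card {(i, k). P i k \<noteq> 0}"
      by (intro psubset_card_mono) auto
    from less.hyps[OF this P'(1)] obtain \<sigma> where "bij \<sigma>"
      "overlap f g P' P' \<le> (\<Sum>i\<in>UNIV. \<Sum>j\<in>UNIV. f i j * g (\<sigma> i) (\<sigma> j))" by blast
    then show ?thesis using P'(2) order_trans by blast
  next
    case False
    then have "P i k = 0 \<or> P i k = 1" for i k
      using le[of i k] less.prems unfolding doubly_stochastic_def
      by (metis less_eq_real_def)
    then obtain \<sigma> where \<sigma>: "bij \<sigma>" "P = (\<lambda>i k. of_bool (k = \<sigma> i))"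
      using integral_doubly_stochastic[OF less.prems] by metis
    have "overlap f g P P = (\<Sum>i\<in>UNIV. \<Sum>j\<in>UNIV. f i j * g (\<sigma> i) (\<sigma> j))"
      unfolding overlap_def \<sigma>(2) by (simp add: mult.assoc flip: sum_distrib_left)
    with \<sigma>(1) show ?thesis by auto
  qed
qed

section \<open>Distortion of realizations and gluing\<close>

text \<open>Couplings are treated as pairs of random variables: a probability space \<open>M\<close> with maps
  to all spaces involved serves couplings, their gluings, and the couplings induced by maps alike.\<close>

definition realizes :: "'c measure \<Rightarrow> 'a measure \<Rightarrow> ('c \<Rightarrow> 'a) \<Rightarrow> bool" where
  "realizes M A u \<longleftrightarrow> prob_space M \<and> u \<in> measurable M A \<and> distr M A u = A"

definition sq_distortion :: "'c measure \<Rightarrow> ('a \<Rightarrow> 'a \<Rightarrow> real) \<Rightarrow> ('c \<Rightarrow> 'a) \<Rightarrow>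
    ('b \<Rightarrow> 'b \<Rightarrow> real) \<Rightarrow> ('c \<Rightarrow> 'b) \<Rightarrow> real" where
  "sq_distortion M f u g v =
     (\<integral>z. (f (u (fst z)) (u (snd z)) - g (v (fst z)) (v (snd z)))\<^sup>2 \<partial>(M \<Otimes>\<^sub>M M))"

lemma distr_pair_map:
  assumes u: "realizes M A u" and v: "realizes N B v"
  shows "distr (M \<Otimes>\<^sub>M N) (A \<Otimes>\<^sub>M B) (\<lambda>z. (u (fst z), v (snd z))) = A \<Otimes>\<^sub>M B"
proof -
  have "sigma_finite_measure (distr N B v)"
    using v unfolding realizes_def by (intro prob_space_imp_sigma_finite prob_space.prob_space_distr) auto
  then have "distr M A u \<Otimes>\<^sub>M distr N B v = distr (M \<Otimes>\<^sub>M N) (A \<Otimes>\<^sub>M B) (\<lambda>(x, y). (u x, v y))"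
    using u v by (intro pair_measure_distr) (auto simp: realizes_def)
  also have "distr M A u \<Otimes>\<^sub>M distr N B v = A \<Otimes>\<^sub>M B" using u v by (simp add: realizes_def)
  finally show ?thesis by (simp add: case_prod_beta')
qed

lemma realizes_compose:
  assumes T: "realizes M M' T" and u: "realizes M' A u"
  shows "realizes M A (\<lambda>w. u (T w))"
proof -
  have "distr M A (u \<circ> T) = distr (distr M M' T) A u"
    using T u by (intro distr_distr[symmetric]) (auto simp: realizes_def)
  also have "\<dots> = A" using T u by (simp add: realizes_def)
  finally show ?thesis
    using T u by (auto simp: realizes_def comp_def)
qed

lemma gauge_measurable:
  assumes "gauged_measure_space G"
  shows "(\<lambda>z. gauging G (fst z) (snd z)) \<in> borel_measurable (mass G \<Otimes>\<^sub>M mass G)"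
  using assms by (simp add: gauged_measure_space_def case_prod_beta')

lemma gauge_pullback:
  assumes G: "gauged_measure_space G" and u: "realizes M (mass G) u"
  shows gauge_pullback_measurable:
      "(\<lambda>z. gauging G (u (fst z)) (u (snd z))) \<in> borel_measurable (M \<Otimes>\<^sub>M M)"
    and gauge_pullback_integrable:
      "integrable (M \<Otimes>\<^sub>M M) (\<lambda>z. (gauging G (u (fst z)) (u (snd z)))\<^sup>2)"
proof -
  let ?T = "\<lambda>z. (u (fst z), u (snd z))"
  have [measurable]: "u \<in> measurable M (mass G)" using u by (simp add: realizes_def)
  have T: "?T \<in> measurable (M \<Otimes>\<^sub>M M) (mass G \<Otimes>\<^sub>M mass G)" by measurable
  show "(\<lambda>z. gauging G (u (fst z)) (u (snd z))) \<in> borel_measurable (M \<Otimes>\<^sub>M M)"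
    using measurable_compose[OF T gauge_measurable[OF G]] by simp
  have "integrable (distr (M \<Otimes>\<^sub>M M) (mass G \<Otimes>\<^sub>M mass G) ?T) (\<lambda>(x, y). (gauging G x y)\<^sup>2)"
    unfolding distr_pair_map[OF u u] using G by (simp add: gauged_measure_space_def)
  from integrable_distr[OF T this]
  show "integrable (M \<Otimes>\<^sub>M M) (\<lambda>z. (gauging G (u (fst z)) (u (snd z)))\<^sup>2)" by simp
qed

lemma sq_distortion_integrable:
  assumes G: "gauged_measure_space G" "realizes M (mass G) u"
    and H: "gauged_measure_space H" "realizes M (mass H) v"
  shows "integrable (M \<Otimes>\<^sub>M M)
    (\<lambda>z. (gauging G (u (fst z)) (u (snd z)) - gauging H (v (fst z)) (v (snd z)))\<^sup>2)"
proof (rule Bochner_Integration.integrable_bound)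
  show "integrable (M \<Otimes>\<^sub>M M)
      (\<lambda>z. 2 * (gauging G (u (fst z)) (u (snd z)))\<^sup>2 + 2 * (gauging H (v (fst z)) (v (snd z)))\<^sup>2)"
    using gauge_pullback_integrable[OF G] gauge_pullback_integrable[OF H] by simp
  show "(\<lambda>z. (gauging G (u (fst z)) (u (snd z)) - gauging H (v (fst z)) (v (snd z)))\<^sup>2)
      \<in> borel_measurable (M \<Otimes>\<^sub>M M)"
    using gauge_pullback_measurable[OF G] gauge_pullback_measurable[OF H] by measurable
  have *: "(a - b)\<^sup>2 \<le> 2 * a\<^sup>2 + 2 * b\<^sup>2" for a b :: real
    using zero_le_power2[of "a + b"] by (simp add: power2_sum power2_diff)
  show "AE z in M \<Otimes>\<^sub>M M.
      norm ((gauging G (u (fst z)) (u (snd z)) - gauging H (v (fst z)) (v (snd z)))\<^sup>2)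
      \<le> norm (2 * (gauging G (u (fst z)) (u (snd z)))\<^sup>2 + 2 * (gauging H (v (fst z)) (v (snd z)))\<^sup>2)"
    by (intro always_eventually allI) (use * in \<open>simp add: abs_of_nonneg\<close>)
qed

lemma sq_distortion_nonneg: "0 \<le> sq_distortion M f u g v"
  unfolding sq_distortion_def by (rule Bochner_Integration.integral_nonneg) simp

lemma sq_distortion_commute: "sq_distortion M f u g v = sq_distortion M g v f u"
  unfolding sq_distortion_def by (simp add: power2_commute)

lemma sq_distortion_transfer:
  assumes T: "realizes M M' T"
    and G: "gauged_measure_space G" "realizes M' (mass G) u"
    and H: "gauged_measure_space H" "realizes M' (mass H) v"
  shows "sq_distortion M (gauging G) (\<lambda>w. u (T w)) (gauging H) (\<lambda>w. v (T w))
       = sq_distortion M' (gauging G) u (gauging H) v"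
proof -
  let ?T = "\<lambda>z. (T (fst z), T (snd z))"
  have [measurable]: "T \<in> measurable M M'" using T by (simp add: realizes_def)
  have "sq_distortion M' (gauging G) u (gauging H) v
    = (\<integral>z. (gauging G (u (fst z)) (u (snd z)) - gauging H (v (fst z)) (v (snd z)))\<^sup>2
        \<partial>distr (M \<Otimes>\<^sub>M M) (M' \<Otimes>\<^sub>M M') ?T)"
    unfolding distr_pair_map[OF T T] sq_distortion_def ..
  also have "\<dots> = sq_distortion M (gauging G) (\<lambda>w. u (T w)) (gauging H) (\<lambda>w. v (T w))"
    unfolding sq_distortion_def
    by (subst integral_distr)
      (use sq_distortion_integrable[OF G H] in \<open>simp_all add: borel_measurable_integrable\<close>)
  finally show ?thesis by simp
qed

lemma couplings_realize:
  assumes "m \<in> couplings A B" shows "realizes m A fst" "realizes m B snd"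
proof -
  have "sets m = sets (A \<Otimes>\<^sub>M B)" using assms by (simp add: couplings_def)
  then have "fst \<in> measurable m A" "snd \<in> measurable m B" by (simp_all cong: measurable_cong_sets)
  then show "realizes m A fst" "realizes m B snd" using assms by (auto simp: realizes_def couplings_def)
qed

lemma realization_coupling:
  assumes u: "realizes M A u" and v: "realizes M B v"
  defines "m \<equiv> distr M (A \<Otimes>\<^sub>M B) (\<lambda>w. (u w, v w))"
  shows "m \<in> couplings A B" "realizes M m (\<lambda>w. (u w, v w))"
proof -
  have [measurable]: "u \<in> measurable M A" "v \<in> measurable M B" using u v by (auto simp: realizes_def)
  have uv: "(\<lambda>w. (u w, v w)) \<in> measurable M (A \<Otimes>\<^sub>M B)" by measurable
  have "distr m A fst = A" "distr m B snd = B"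
    unfolding m_def using u v by (simp_all add: distr_distr comp_def realizes_def)
  moreover have "prob_space m"
    unfolding m_def using u uv by (auto simp: realizes_def intro!: prob_space.prob_space_distr)
  ultimately show "m \<in> couplings A B" by (simp add: couplings_def m_def)
  have "distr M m (\<lambda>w. (u w, v w)) = m" unfolding m_def by (rule distr_cong) auto
  then show "realizes M m (\<lambda>w. (u w, v w))"
    using u uv by (simp add: realizes_def m_def)
qed

lemma distortion_dist_eq:
  assumes G: "gauged_measure_space G" and H: "gauged_measure_space H"
  shows "distortion_dist G H = (INF m\<in>couplings (mass G) (mass H).
    sqrt (sq_distortion m (gauging G) fst (gauging H) snd))"
  unfolding distortion_dist_def
proof (intro INF_cong refl)
  fix m assume m: "m \<in> couplings (mass G) (mass H)"
  note r = couplings_realize[OF m]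
  interpret prob_space m using m by (simp add: couplings_def)
  interpret pair_sigma_finite m m ..
  have "(\<integral>y. \<integral>x. (gauging G (fst x) (fst y) - gauging H (snd x) (snd y))\<^sup>2 \<partial>m \<partial>m)
    = sq_distortion m (gauging G) fst (gauging H) snd"
    unfolding sq_distortion_def
    using integral_snd[of "\<lambda>x y. (gauging G (fst x) (fst y) - gauging H (snd x) (snd y))\<^sup>2"]
      sq_distortion_integrable[OF G r(1) H r(2)]
    by (simp add: case_prod_beta')
  then show "sqrt (\<integral>(y1, y2). (\<integral>(x1, x2). \<bar>gauging G x1 y1 - gauging H x2 y2\<bar>\<^sup>2 \<partial>m) \<partial>m)
    = sqrt (sq_distortion m (gauging G) fst (gauging H) snd)"
    by (simp add: case_prod_beta')
qed

text \<open>Any joint realization bounds the distance, since its joint law is a coupling.\<close>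

lemma distortion_dist_le:
  assumes G: "gauged_measure_space G" "realizes M (mass G) u"
    and H: "gauged_measure_space H" "realizes M (mass H) v"
  shows "distortion_dist G H \<le> sqrt (sq_distortion M (gauging G) u (gauging H) v)"
proof -
  let ?m = "distr M (mass G \<Otimes>\<^sub>M mass H) (\<lambda>w. (u w, v w))"
  note m = realization_coupling[OF G(2) H(2)]
  have "distortion_dist G H \<le> sqrt (sq_distortion ?m (gauging G) fst (gauging H) snd)"
    unfolding distortion_dist_eq[OF G(1) H(1)]
    by (intro cINF_lower m bdd_belowI2[of _ 0]) (simp add: sq_distortion_nonneg)
  also have "sq_distortion ?m (gauging G) fst (gauging H) snd
      = sq_distortion M (gauging G) u (gauging H) v"
    using sq_distortion_transfer[OF m(2) G(1) couplings_realize(1)[OF m(1)]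
        H(1) couplings_realize(2)[OF m(1)]] by simp
  finally show ?thesis .
qed

lemma couplings_nonempty:
  assumes "prob_space A" "prob_space B" shows "couplings A B \<noteq> {}"
proof -
  interpret A: prob_space A by fact
  interpret B: prob_space B by fact
  interpret pair_prob_space A B ..
  have "realizes (A \<Otimes>\<^sub>M B) A fst"
    using B.distr_pair_fst[of A] prob_space_axioms by (simp add: realizes_def)
  moreover have "distr (A \<Otimes>\<^sub>M B) B snd = distr (B \<Otimes>\<^sub>M A) B fst"
    by (subst distr_pair_swap, subst distr_distr) (auto simp: comp_def case_prod_beta')
  then have "realizes (A \<Otimes>\<^sub>M B) B snd"
    using A.distr_pair_fst[of B] prob_space_axioms by (simp add: realizes_def)
  ultimately show ?thesis using realization_coupling by blast
qed

lemma distortion_dist_greatest: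
  assumes G: "gauged_measure_space G" and H: "gauged_measure_space H"
    and le: "\<And>m. m \<in> couplings (mass G) (mass H) \<Longrightarrow>
        x \<le> sqrt (sq_distortion m (gauging G) fst (gauging H) snd)"
  shows "x \<le> distortion_dist G H"
  unfolding distortion_dist_eq[OF G H]
  using G H by (intro cINF_greatest couplings_nonempty le) (auto simp: gauged_measure_space_def)

lemma distortion_dist_nonneg:
  assumes "gauged_measure_space G" "gauged_measure_space H"
  shows "0 \<le> distortion_dist G H"
  by (rule distortion_dist_greatest[OF assms]) (simp add: sq_distortion_nonneg)

lemma distortion_dist_commute_le:
  assumes G: "gauged_measure_space G" and H: "gauged_measure_space H"
  shows "distortion_dist H G \<le> distortion_dist G H"
proof (rule distortion_dist_greatest[OF assms])
  fix m assume "m \<in> couplings (mass G) (mass H)"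
  note r = couplings_realize[OF this]
  show "distortion_dist H G \<le> sqrt (sq_distortion m (gauging G) fst (gauging H) snd)"
    using distortion_dist_le[OF H r(2) G r(1)]
    by (subst sq_distortion_commute[of m "gauging G" fst "gauging H" snd])
qed

lemma distortion_dist_commute:
  "gauged_measure_space G \<Longrightarrow> gauged_measure_space H \<Longrightarrow> distortion_dist G H = distortion_dist H G"
  by (intro antisym distortion_dist_commute_le)

lemma distortion_dist_zeroE:
  assumes G: "gauged_measure_space G" and H: "gauged_measure_space H"
    and "distortion_dist G H = 0" "0 < e"
  obtains m where "m \<in> couplings (mass G) (mass H)"
    "sq_distortion m (gauging G) fst (gauging H) snd < e"
proof -
  have "\<exists>m\<in>couplings (mass G) (mass H). sq_distortion m (gauging G) fst (gauging H) snd < e"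
  proof (rule ccontr)
    assume "\<not> ?thesis"
    then have "sqrt e \<le> distortion_dist G H"
      by (intro distortion_dist_greatest[OF G H] real_sqrt_le_mono) force
    with assms show False by simp
  qed
  then show ?thesis using that by blast
qed

text \<open>Let \<open>p\<close> be the density of \<open>m\<close> with respect to the product of its marginals. For
  almost every \<open>y\<close>, \<open>p (x, y)\<close> is the conditional density of \<open>x\<close> given
  \<open>y\<close>, so weighting the product of \<open>A\<close> and \<open>m'\<close> with
  \<open>p (x, y)\<close> makes \<open>x\<close> and \<open>z\<close> conditionally independent
  given \<open>y\<close>.\<close>

lemma glue_couplings:
  assumes m: "m \<in> couplings A B" and m': "m' \<in> couplings B C"
    and prob: "prob_space A" "prob_space B"
    and ac: "absolutely_continuous (A \<Otimes>\<^sub>M B) m"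
  obtains M where "realizes M m (\<lambda>w. (fst w, fst (snd w)))" "realizes M m' snd"
proof -
  interpret A: prob_space A by fact
  interpret B: prob_space B by fact
  interpret AB: pair_prob_space A B ..
  interpret m': prob_space m' using m' by (simp add: couplings_def)
  interpret Am': pair_prob_space A m' ..
  have setm: "sets m = sets (A \<Otimes>\<^sub>M B)" using m by (simp add: couplings_def)
  have setm': "sets m' = sets (B \<Otimes>\<^sub>M C)" using m' by (simp add: couplings_def)
  obtain p where p[measurable]: "p \<in> borel_measurable (A \<Otimes>\<^sub>M B)" and dp: "density (A \<Otimes>\<^sub>M B) p = m"
    using AB.Radon_Nikodym[OF ac setm] by blast
  note r = couplings_realize[OF m] and r' = couplings_realize[OF m']
  have [measurable]: "fst \<in> measurable m' B" using r' by (simp add: realizes_def)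
  define q where "q y = (\<integral>\<^sup>+x. p (x, y) \<partial>A)" for y
  have q[measurable]: "q \<in> borel_measurable B" unfolding q_def by measurable
  \<comment> \<open>The density integrates to 1 in its first argument for almost every second argument, because the second marginal of \<open>m\<close> is \<open>B\<close>.\<close>
  have "density B q = B"
  proof (rule measure_eqI)
    fix E assume "E \<in> sets (density B q)"
    then have E[measurable]: "E \<in> sets B" by simp
    have "emeasure (density B q) E = (\<integral>\<^sup>+y. \<integral>\<^sup>+x. p (x, y) * indicator E y \<partial>A \<partial>B)"
      using E by (subst emeasure_density) (auto simp: q_def intro!: nn_integral_cong nn_integral_multc[symmetric])
    also have "\<dots> = (\<integral>\<^sup>+z. p z * indicator E (snd z) \<partial>(A \<Otimes>\<^sub>M B))"
      by (subst AB.nn_integral_snd[symmetric]) simp_all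
    also have "\<dots> = (\<integral>\<^sup>+z. p z * indicator (snd -` E \<inter> space (A \<Otimes>\<^sub>M B)) z \<partial>(A \<Otimes>\<^sub>M B))"
      by (intro nn_integral_cong) (simp add: indicator_def)
    also have "\<dots> = emeasure m (snd -` E \<inter> space m)"
      unfolding dp[symmetric] by (subst emeasure_density) (simp_all)
    also have "\<dots> = emeasure (distr m B snd) E"
      using r(2) E unfolding realizes_def by (subst emeasure_distr) auto
    also have "\<dots> = emeasure B E" using r(2) by (simp add: realizes_def)
    finally show "emeasure (density B q) E = emeasure B E" .
  qed simp
  then have "AE y in B. q y = 1"
    by (intro B.density_unique[of q "\<lambda>_. 1"]) (simp_all add: density_1)
  moreover have "distr m' B fst = B" using r'(1) by (simp add: realizes_def)
  ultimately have "AE y in distr m' B fst. q y = 1" by (simp only:)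
  then have q1: "AE z in m'. q (fst z) = 1"
    by (rule AE_distrD[rotated]) simp
  let ?T = "\<lambda>w :: 'a \<times> 'b \<times> 'c. (fst w, fst (snd w))"
  define M where "M = density (A \<Otimes>\<^sub>M m') (\<lambda>w. p (?T w))"
  have T[measurable]: "?T \<in> measurable (A \<Otimes>\<^sub>M m') (A \<Otimes>\<^sub>M B)" by measurable
  have snd: "distr M m' snd = m'"
  proof (rule measure_eqI)
    fix E assume "E \<in> sets (distr M m' snd)"
    then have E[measurable]: "E \<in> sets m'" by simp
    have "emeasure (distr M m' snd) E = emeasure M (snd -` E \<inter> space M)"
      by (intro emeasure_distr) (simp_all add: M_def)
    also have "\<dots> = (\<integral>\<^sup>+w. p (?T w) * indicator (snd -` E \<inter> space (A \<Otimes>\<^sub>M m')) w \<partial>(A \<Otimes>\<^sub>M m'))"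
      unfolding M_def by (subst emeasure_density) simp_all
    also have "\<dots> = (\<integral>\<^sup>+w. p (?T w) * indicator E (snd w) \<partial>(A \<Otimes>\<^sub>M m'))"
      by (intro nn_integral_cong) (simp add: indicator_def)
    also have "\<dots> = (\<integral>\<^sup>+z. \<integral>\<^sup>+x. p (x, fst z) * indicator E z \<partial>A \<partial>m')"
      by (subst Am'.nn_integral_snd[symmetric]) simp_all
    also have "\<dots> = (\<integral>\<^sup>+z. q (fst z) * indicator E z \<partial>m')"
      unfolding q_def by (intro nn_integral_cong nn_integral_multc) (simp add: space_pair_measure)
    also have "\<dots> = (\<integral>\<^sup>+z. indicator E z \<partial>m')"
      using q1 by (intro nn_integral_cong_AE) auto
    finally show "emeasure (distr M m' snd) E = emeasure m' E" by simp
  qed simp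
  have sndM: "snd \<in> measurable M m'" by (simp add: M_def)
  have "emeasure M (space M) = emeasure (distr M m' snd) (space m')"
    using sndM by (subst emeasure_distr) (auto simp: M_def space_pair_measure intro!: arg_cong2[where f=emeasure])
  then have "prob_space M" unfolding snd by (intro prob_spaceI) (simp add: m'.emeasure_space_1)
  have "realizes A A (\<lambda>x. x)" using prob by (simp add: realizes_def)
  from distr_pair_map[OF this r'(1)]
  have "distr (A \<Otimes>\<^sub>M m') (A \<Otimes>\<^sub>M B) ?T = A \<Otimes>\<^sub>M B" .
  then have "distr M (A \<Otimes>\<^sub>M B) ?T = m"
    unfolding M_def using density_distr[OF p T] dp by simp
  moreover have "distr M m ?T = distr M (A \<Otimes>\<^sub>M B) ?T"
    using setm by (intro distr_cong) auto
  moreover have "?T \<in> measurable M m"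
    using T setm unfolding M_def by (simp cong: measurable_cong_sets)
  ultimately have "realizes M m ?T" using \<open>prob_space M\<close> by (simp add: realizes_def)
  moreover have "realizes M m' snd" using \<open>prob_space M\<close> sndM snd by (simp add: realizes_def)
  ultimately show ?thesis by (rule that)
qed

text \<open>Replaces Minkowski's inequality below: when the distance of the first two spaces vanishes, the term
  with factor \<open>1 + 1 / e\<close> is arbitrarily small for each fixed \<open>e\<close>.\<close>

lemma weighted_square_triangle:
  fixes a b c e :: real
  assumes "0 < e" shows "(a - c)\<^sup>2 \<le> (1 + e) * (b - c)\<^sup>2 + (1 + 1 / e) * (a - b)\<^sup>2"
proof -
  have "0 \<le> (e * (b - c) - (a - b))\<^sup>2 / e" using assms by simp
  also have "\<dots> = (1 + e) * (b - c)\<^sup>2 + (1 + 1 / e) * (a - b)\<^sup>2 - (a - c)\<^sup>2"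
    using assms by (simp add: field_simps power2_eq_square)
  finally show ?thesis by simp
qed

text \<open>A vanishing distance provides couplings of arbitrarily small squared distortion
  \<open>d\<close>. These are glued to \<open>m'\<close>; first \<open>d\<close>, then
  \<open>e\<close> tends to 0.\<close>

lemma distortion_dist_le_of_zero:
  assumes G: "gauged_measure_space G" and H: "gauged_measure_space H" and K: "gauged_measure_space K"
    and zero: "distortion_dist G H = 0"
    and ac: "\<And>m. m \<in> couplings (mass G) (mass H) \<Longrightarrow> absolutely_continuous (mass G \<Otimes>\<^sub>M mass H) m"
  shows "distortion_dist G K \<le> distortion_dist H K"
proof (rule distortion_dist_greatest[OF H K])
  fix m' assume m': "m' \<in> couplings (mass H) (mass K)"
  define D where "D = sq_distortion m' (gauging H) fst (gauging K) snd"
  have prob: "prob_space (mass G)" "prob_space (mass H)"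
    using G H by (auto simp: gauged_measure_space_def)
  have le: "(distortion_dist G K)\<^sup>2 \<le> (1 + e) * D + (1 + 1 / e) * d" if "0 < e" "0 < d" for e d
  proof -
    obtain m where m: "m \<in> couplings (mass G) (mass H)"
      and small: "sq_distortion m (gauging G) fst (gauging H) snd < d"
      using distortion_dist_zeroE[OF G H zero \<open>0 < d\<close>] by blast
    obtain M where M: "realizes M m (\<lambda>w. (fst w, fst (snd w)))" "realizes M m' snd"
      using glue_couplings[OF m m' prob ac[OF m]] by blast
    have u: "realizes M (mass G) (\<lambda>w. fst w)" and v: "realizes M (mass H) (\<lambda>w. fst (snd w))"
      and w: "realizes M (mass K) (\<lambda>w. snd (snd w))"
      using realizes_compose[OF M(1) couplings_realize(1)[OF m]]
        realizes_compose[OF M(2) couplings_realize(1)[OF m']]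
        realizes_compose[OF M(2) couplings_realize(2)[OF m']] by simp_all
    let ?D = "\<lambda>f u g v z. (f (u (fst z)) (u (snd z)) - g (v (fst z)) (v (snd z)))\<^sup>2 :: real"
    let ?u = "\<lambda>w. fst w" and ?v = "\<lambda>w. fst (snd w)" and ?w = "\<lambda>w. snd (snd w)"
    have "(distortion_dist G K)\<^sup>2 \<le> sq_distortion M (gauging G) ?u (gauging K) ?w"
      using power_mono[OF distortion_dist_le[OF G u K w] distortion_dist_nonneg[OF G K], of 2]
      by (simp add: sq_distortion_nonneg)
    also have "\<dots> \<le> (\<integral>z. (1 + e) * ?D (gauging H) ?v (gauging K) ?w z
        + (1 + 1 / e) * ?D (gauging G) ?u (gauging H) ?v z \<partial>(M \<Otimes>\<^sub>M M))"
      unfolding sq_distortion_def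
      by (intro integral_mono weighted_square_triangle \<open>0 < e\<close> Bochner_Integration.integrable_add
          integrable_mult_right sq_distortion_integrable G H K u v w)
    also have "\<dots> = (1 + e) * sq_distortion M (gauging H) ?v (gauging K) ?w
        + (1 + 1 / e) * sq_distortion M (gauging G) ?u (gauging H) ?v"
      unfolding sq_distortion_def
      by (subst Bochner_Integration.integral_add)
        (intro integrable_mult_right sq_distortion_integrable G H K u v w | simp)+
    also have "sq_distortion M (gauging H) ?v (gauging K) ?w = D"
      unfolding D_def
      by (rule sq_distortion_transfer[OF M(2) H couplings_realize(1)[OF m'] K couplings_realize(2)[OF m']])
    also have "sq_distortion M (gauging G) ?u (gauging H) ?v
        = sq_distortion m (gauging G) fst (gauging H) snd"
      using sq_distortion_transfer[OF M(1) G couplings_realize(1)[OF m] H couplings_realize(2)[OF m]]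
      by simp
    also have "(1 + e) * D + (1 + 1 / e) * \<dots> \<le> (1 + e) * D + (1 + 1 / e) * d"
      using small \<open>0 < e\<close> by (intro add_left_mono mult_left_mono) auto
    finally show ?thesis .
  qed
  have "(distortion_dist G K)\<^sup>2 \<le> (1 + e) * D" if "0 < e" for e
  proof (rule tendsto_lowerbound)
    show "((\<lambda>d. (1 + e) * D + (1 + 1 / e) * d) \<longlongrightarrow> (1 + e) * D) (at_right 0)"
      by (auto intro!: tendsto_eq_intros)
    show "\<forall>\<^sub>F d in at_right 0. (distortion_dist G K)\<^sup>2 \<le> (1 + e) * D + (1 + 1 / e) * d"
      using le that by (auto simp: eventually_at_right_less intro!: eventually_at_rightI[of 0 1])
  qed simp
  then have "(distortion_dist G K)\<^sup>2 \<le> D"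
  proof (intro tendsto_lowerbound[of "\<lambda>e. (1 + e) * D"])
    show "((\<lambda>e. (1 + e) * D) \<longlongrightarrow> D) (at_right 0)" by (auto intro!: tendsto_eq_intros)
  qed (auto intro!: eventually_at_rightI[of 0 1])
  then show "distortion_dist G K \<le> sqrt (sq_distortion m' (gauging H) fst (gauging K) snd)"
    unfolding D_def by (rule real_le_rsqrt)
qed

section \<open>Homomorphism classes of finite spaces\<close>

abbreviation uniform :: "'n::finite measure" where
  "uniform \<equiv> uniform_count_measure UNIV"

lemma prob_space_uniform: "prob_space (uniform :: 'n::finite measure)"
  by (rule prob_space_uniform_count_measure) auto

lemma realizes_id: "prob_space M \<Longrightarrow> realizes M M (\<lambda>x. x)"
  by (simp add: realizes_def)

lemma realizes_uniform_bij:
  assumes u: "bij_betw u S T" and S: "finite S" "S \<noteq> {}"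
  shows "realizes (uniform_count_measure S) (uniform_count_measure T) u"
proof -
  have T: "finite T" using bij_betw_finite[OF u] S by simp
  have meas: "u \<in> measurable (uniform_count_measure S) (uniform_count_measure T)"
    using bij_betw_apply[OF u]
    by (auto simp: measurable_def space_uniform_count_measure sets_uniform_count_measure)
  have "distr (uniform_count_measure S) (uniform_count_measure T) u = uniform_count_measure T"
  proof (rule measure_eqI)
    fix E assume "E \<in> sets (distr (uniform_count_measure S) (uniform_count_measure T) u)"
    then have E: "E \<subseteq> T" by (simp add: sets_uniform_count_measure)
    have "bij_betw u (u -` E \<inter> S) E"
      using u E unfolding bij_betw_def by (auto intro: inj_on_subset)
    then have "card (u -` E \<inter> S) = card E" by (rule bij_betw_same_card)
    moreover have "card S = card T" using u by (rule bij_betw_same_card)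
    ultimately show "emeasure (distr (uniform_count_measure S) (uniform_count_measure T) u) E
        = emeasure (uniform_count_measure T) E"
      using meas E S T
      by (simp add: emeasure_distr sets_uniform_count_measure space_uniform_count_measure
          emeasure_uniform_count_measure)
  qed simp
  with meas S show ?thesis
    by (simp add: realizes_def prob_space_uniform_count_measure)
qed

text \<open>Homomorphism classes of matrix spaces are not empty: the index type embeds into the reals, and the
  uniform measure on the image is a representative.\<close>

lemma gauged_matrix_space_real:
  fixes f :: "real^'n^'n::finite"
  assumes f: "f \<in> sym_matrices"
  shows "\<exists>H :: real gauged_space. gauged_measure_space H \<and> distortion_dist (matrix_space f) H = 0"
proof -
  define \<iota> :: "'n \<Rightarrow> real" where "\<iota> i = real (to_nat i)" for i
  have \<iota>: "inj \<iota>" by (auto simp: inj_on_def \<iota>_def)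
  let ?S = "range \<iota>"
  define M where "M = uniform_count_measure ?S"
  define h where "h x y = f $ inv \<iota> x $ inv \<iota> y" for x y
  define H where "H = \<lparr>points = discrete_topology ?S, gauging = h, mass = M\<rparr>"
  interpret M: prob_space M
    unfolding M_def by (rule prob_space_uniform_count_measure) auto
  interpret MM: pair_prob_space M M ..
  have "sets (M \<Otimes>\<^sub>M M) = sets (count_space ?S \<Otimes>\<^sub>M count_space ?S)"
    unfolding M_def by (intro sets_pair_measure_cong sets_uniform_count_measure_count_space)
  also have "\<dots> = sets (count_space (?S \<times> ?S))"
    by (subst pair_measure_countable) (auto simp: countable_finite)
  finally have sets: "sets (M \<Otimes>\<^sub>M M) = sets (count_space (?S \<times> ?S))" .
  have meas: "k \<in> borel_measurable (M \<Otimes>\<^sub>M M)" for k :: "real \<times> real \<Rightarrow> real"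
    by (simp add: measurable_cong_sets[OF sets refl])
  have "integrable (M \<Otimes>\<^sub>M M) (\<lambda>(x, y). (h x y)\<^sup>2)"
  proof (rule MM.integrable_const_bound)
    show "AE z in M \<Otimes>\<^sub>M M. norm (case z of (x, y) \<Rightarrow> (h x y)\<^sup>2)
        \<le> Max (range (\<lambda>(i, j). (f $ i $ j)\<^sup>2))"
    proof (intro always_eventually allI)
      fix z :: "real \<times> real"
      show "norm (case z of (x, y) \<Rightarrow> (h x y)\<^sup>2) \<le> Max (range (\<lambda>(i, j). (f $ i $ j)\<^sup>2))"
        by (intro Max_ge image_eqI[of _ _ "(inv \<iota> (fst z), inv \<iota> (snd z))"])
          (simp_all add: h_def case_prod_beta')
    qed
  qed (rule meas)
  moreover have "sets M = sets (sigma ?S (Pow ?S))"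
    by (simp add: M_def sets_uniform_count_measure sigma_algebra.sigma_sets_eq sigma_algebra_Pow)
  moreover have "{U. U \<subseteq> ?S} = Pow ?S" by auto
  moreover have "polish_topology (discrete_topology ?S)"
    by (simp add: polish_topology_def completely_metrizable_space_discrete_topology
        separable_space_discrete_topology countable_finite)
  ultimately have H: "gauged_measure_space H"
    using f meas M.prob_space_axioms
    by (simp add: gauged_measure_space_def H_def sym_matrices_def h_def)
  have "bij_betw \<iota> UNIV ?S" using \<iota> by (simp add: bij_betw_def)
  then have u: "realizes uniform (mass H) \<iota>"
    using realizes_uniform_bij[of \<iota> UNIV ?S] by (simp add: H_def M_def)
  have v: "realizes uniform (mass (matrix_space f)) (\<lambda>x. x)"
    by (simp add: matrix_space_def realizes_id prob_space_uniform)
  have "distortion_dist (matrix_space f) H \<le> 0"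
    using distortion_dist_le[OF gauged_measure_space_matrix_space[OF f] v H u] \<iota>
    by (simp add: sq_distortion_def matrix_space_def H_def h_def)
  then have "distortion_dist (matrix_space f) H = 0"
    using distortion_dist_nonneg[OF gauged_measure_space_matrix_space[OF f] H] by simp
  with H show ?thesis by blast
qed

lemma AE_uniform: "(AE i in uniform. Q i) \<Longrightarrow> Q (i :: 'n::finite)"
  unfolding uniform_count_measure_def by (subst (asm) AE_point_measure) (auto simp: zero_less_divide_iff)

text \<open>A null set of the product has null sections over each of the finitely many atoms; as the second
  marginal of \<open>m\<close> is \<open>B\<close>, their union is invisible to \<open>m\<close>.\<close>

lemma coupling_uniform_ac_left:
  fixes m :: "('n::finite \<times> 'b) measure"
  assumes m: "m \<in> couplings uniform B" and B: "prob_space B"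
  shows "absolutely_continuous (uniform \<Otimes>\<^sub>M B) m"
  unfolding absolutely_continuous_def
proof
  fix N :: "('n \<times> 'b) set" assume N: "N \<in> null_sets (uniform \<Otimes>\<^sub>M B)"
  interpret B: prob_space B by fact
  interpret A: prob_space "uniform :: 'n measure" by (rule prob_space_uniform)
  interpret AB: pair_prob_space "uniform :: 'n measure" B ..
  have "AE z in uniform \<Otimes>\<^sub>M B. z \<notin> N" using N by (rule AE_not_in)
  then have "AE i in (uniform :: 'n measure). AE y in B. (i, y) \<notin> N" by (rule AB.AE_pair)
  then have "AE y in B. (i, y) \<notin> N" for i :: 'n by (rule AE_uniform)
  then have "AE y in B. \<forall>i. (i, y) \<notin> N" by (simp add: AE_all_countable)
  moreover have "distr m B snd = B" "snd \<in> measurable m B"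
    using couplings_realize(2)[OF m] by (auto simp: realizes_def)
  ultimately have "AE z in m. \<forall>i. (i, snd z) \<notin> N"
    using AE_distrD[of snd m B "\<lambda>y. \<forall>i. (i, y) \<notin> N"] by (simp only:)
  then have "AE z in m. z \<notin> N" by eventually_elim (metis prod.collapse)
  moreover have "N \<in> sets m" using N m by (auto simp: couplings_def)
  ultimately show "N \<in> null_sets m" by (simp add: AE_iff_null_sets)
qed

lemma coupling_uniform_ac_right:
  fixes m :: "('b \<times> 'n::finite) measure"
  assumes m: "m \<in> couplings B uniform" and B: "prob_space B"
  shows "absolutely_continuous (B \<Otimes>\<^sub>M uniform) m"
  unfolding absolutely_continuous_def
proof
  fix N :: "('b \<times> 'n) set" assume N: "N \<in> null_sets (B \<Otimes>\<^sub>M uniform)"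
  interpret B: prob_space B by fact
  interpret A: prob_space "uniform :: 'n measure" by (rule prob_space_uniform)
  interpret BA: pair_prob_space B "uniform :: 'n measure" ..
  have "AE z in B \<Otimes>\<^sub>M uniform. z \<notin> N" using N by (rule AE_not_in)
  then have "AE x in B. AE i in (uniform :: 'n measure). (x, i) \<notin> N" by (rule BA.AE_pair)
  then have "AE x in B. \<forall>i. (x, i) \<notin> N" by eventually_elim (blast dest: AE_uniform)
  moreover have "distr m B fst = B" "fst \<in> measurable m B"
    using couplings_realize(1)[OF m] by (auto simp: realizes_def)
  ultimately have "AE z in m. \<forall>i. (fst z, i) \<notin> N"
    using AE_distrD[of fst m B "\<lambda>x. \<forall>i. (x, i) \<notin> N"] by (simp only:)
  then have "AE z in m. z \<notin> N" by eventually_elim (metis prod.collapse)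
  moreover have "N \<in> sets m" using N m by (auto simp: couplings_def)
  ultimately show "N \<in> null_sets m" by (simp add: AE_iff_null_sets)
qed

lemma mass_matrix_space [simp]: "mass (matrix_space f) = uniform"
  by (simp add: matrix_space_def)

lemma gauging_matrix_space [simp]: "gauging (matrix_space f) = (\<lambda>i j. f $ i $ j)"
  by (simp add: matrix_space_def)

text \<open>In the first inequality the finite space is the middle one of the gluing, in the second it is an
  outer one; in both cases one of the marginals of the first coupling is uniform.\<close>

lemma distortion_dist_homomorphic:
  fixes f :: "real^'n^'n::finite"
  assumes f: "f \<in> sym_matrices" and G: "gauged_measure_space G" and K: "gauged_measure_space K"
    and zero: "distortion_dist (matrix_space f) G = 0"
  shows "distortion_dist G K = distortion_dist (matrix_space f) K"
proof (rule antisym)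
  note gf = gauged_measure_space_matrix_space[OF f]
  have prob: "prob_space (mass G)" using G by (simp add: gauged_measure_space_def)
  show "distortion_dist G K \<le> distortion_dist (matrix_space f) K"
    using zero distortion_dist_commute[OF gf G]
    by (intro distortion_dist_le_of_zero[OF G gf K])
      (simp_all add: coupling_uniform_ac_right prob)
  show "distortion_dist (matrix_space f) K \<le> distortion_dist G K"
    using zero by (intro distortion_dist_le_of_zero[OF gf G K])
      (simp_all add: coupling_uniform_ac_left prob)
qed

lemma the_elem_image_const:
  assumes "A \<noteq> {}" "\<And>x. x \<in> A \<Longrightarrow> h x = c" shows "the_elem (h ` A) = c"
proof -
  have "h ` A = {c}" using assms by force
  then show ?thesis by simp
qed

lemma distortion_class_dist_matrix:
  fixes f g :: "real^'n^'n::finite"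
  assumes f: "f \<in> sym_matrices" and g: "g \<in> sym_matrices"
  shows "distortion_class_dist (homomorphism_class (matrix_space f)) (homomorphism_class (matrix_space g))
    = distortion_dist (matrix_space f) (matrix_space g)"
  unfolding distortion_class_dist_def
proof (rule the_elem_image_const)
  show "homomorphism_class (matrix_space f) \<times> homomorphism_class (matrix_space g) \<noteq> {}"
    using gauged_matrix_space_real[OF f] gauged_matrix_space_real[OF g]
    by (auto simp: homomorphism_class_def homomorphic_def)
  fix z assume "z \<in> homomorphism_class (matrix_space f) \<times> homomorphism_class (matrix_space g)"
  then obtain G H where z: "z = (G, H)" and G: "gauged_measure_space G" "distortion_dist (matrix_space f) G = 0"
    and H: "gauged_measure_space H" "distortion_dist (matrix_space g) H = 0"
    by (auto simp: homomorphism_class_def homomorphic_def)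
  note gf = gauged_measure_space_matrix_space[OF f] and gg = gauged_measure_space_matrix_space[OF g]
  have "distortion_dist G H = distortion_dist (matrix_space f) H"
    by (rule distortion_dist_homomorphic[OF f G(1) H(1) G(2)])
  also have "\<dots> = distortion_dist H (matrix_space f)"
    by (rule distortion_dist_commute[OF gf H(1)])
  also have "\<dots> = distortion_dist (matrix_space g) (matrix_space f)"
    by (rule distortion_dist_homomorphic[OF g H(1) gf H(2)])
  also have "\<dots> = distortion_dist (matrix_space f) (matrix_space g)"
    by (rule distortion_dist_commute[OF gg gf])
  finally show "(case z of (G, H) \<Rightarrow> distortion_dist G H) = distortion_dist (matrix_space f) (matrix_space g)"
    by (simp add: z)
qed


section \<open>Couplings of uniform measures\<close>

lemma integral_finite_type:
  fixes h :: "'z::finite \<Rightarrow> real"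
  assumes "finite_measure m" "sets m = UNIV"
  shows "integral\<^sup>L m h = (\<Sum>z\<in>UNIV. measure m {z} * h z)"
proof -
  interpret finite_measure m by fact
  have "integral\<^sup>L m h = (\<integral>x. (\<Sum>z\<in>UNIV. h z * indicator {z} x) \<partial>m)"
    by (intro arg_cong[where f = "integral\<^sup>L m"]) (simp add: fun_eq_iff indicator_def)
  also have "\<dots> = (\<Sum>z\<in>UNIV. \<integral>x. h z * indicator {z} x \<partial>m)"
    by (rule Bochner_Integration.integral_sum)
      (simp add: assms fmeasurable_eq_sets integrable_real_indicator less_top[symmetric])
  also have "\<dots> = (\<Sum>z\<in>UNIV. measure m {z} * h z)"
    using assms sets_eq_imp_space_eq[of m "count_space UNIV"] by (simp add: mult.commute)
  finally show ?thesis .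
qed

lemma integral_pair_finite_type:
  fixes h :: "'z::finite \<times> 'z \<Rightarrow> real"
  assumes m: "prob_space m" and sets: "sets m = UNIV"
  shows "integral\<^sup>L (m \<Otimes>\<^sub>M m) h = (\<Sum>a\<in>UNIV. \<Sum>b\<in>UNIV. measure m {a} * measure m {b} * h (a, b))"
proof -
  interpret prob_space m by fact
  interpret mm: pair_prob_space m m ..
  have "sets (m \<Otimes>\<^sub>M m) = sets (count_space UNIV \<Otimes>\<^sub>M count_space UNIV)"
    by (intro sets_pair_measure_cong) (simp_all add: sets)
  also have "\<dots> = UNIV" by (subst sets_pair_countable) auto
  finally have "sets (m \<Otimes>\<^sub>M m) = UNIV" .
  then have "integral\<^sup>L (m \<Otimes>\<^sub>M m) h = (\<Sum>z\<in>UNIV. measure (m \<Otimes>\<^sub>M m) {z} * h z)"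
    by (intro integral_finite_type) unfold_locales
  moreover have "measure (m \<Otimes>\<^sub>M m) {(a, b)} = measure m {a} * measure m {b}" for a b
    using emeasure_pair_measure_Times[of "{a}" m "{b}"] sets
    by (simp add: measure_def enn2real_mult)
  ultimately show ?thesis by (simp add: sum_UNIV_prod)
qed

lemma sq_distortion_permutation:
  fixes f g :: "real^'n^'n::finite"
  shows "sqrt (sq_distortion uniform (\<lambda>i j. f $ i $ j) (\<lambda>x. x) (\<lambda>i j. g $ i $ j) \<sigma>)
    = matrix_nrm (f - relabel \<sigma> g)"
proof -
  have [simp]: "measure uniform {i} = 1 / CARD('n)" for i :: 'n
    by (simp add: measure_uniform_count_measure)
  have "sq_distortion uniform (\<lambda>i j. f $ i $ j) (\<lambda>x. x) (\<lambda>i j. g $ i $ j) \<sigma>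
    = (\<Sum>i\<in>UNIV. \<Sum>j\<in>UNIV. 1 / CARD('n) * (1 / CARD('n)) * (f $ i $ j - g $ \<sigma> i $ \<sigma> j)\<^sup>2)"
    unfolding sq_distortion_def
    by (subst integral_pair_finite_type)
      (simp_all add: prob_space_uniform sets_uniform_count_measure)
  then show ?thesis
    by (simp add: matrix_nrm_def relabel_def sum_distrib_left power2_eq_square)
qed

lemma distortion_dist_le_permutation:
  fixes f g :: "real^'n^'n::finite"
  assumes "f \<in> sym_matrices" "g \<in> sym_matrices" "bij \<sigma>"
  shows "distortion_dist (matrix_space f) (matrix_space g) \<le> matrix_nrm (f - relabel \<sigma> g)"
proof -
  have "realizes uniform (mass (matrix_space f)) (\<lambda>x. x)" "realizes uniform (mass (matrix_space g)) \<sigma>"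
    using realizes_uniform_bij[of \<sigma> UNIV UNIV] assms(3)
    by (simp_all add: realizes_id prob_space_uniform)
  from distortion_dist_le[OF gauged_measure_space_matrix_space[OF assms(1)] this(1)
      gauged_measure_space_matrix_space[OF assms(2)] this(2)]
  show ?thesis by (simp add: sq_distortion_permutation)
qed

text \<open>Expand the square; the pure terms depend only on the margins of \<open>P\<close>.\<close>

lemma sq_distortion_coupling:
  fixes f g :: "'n::finite \<Rightarrow> 'n \<Rightarrow> real"
  assumes m: "m \<in> couplings uniform uniform"
  defines "P \<equiv> \<lambda>i k. CARD('n) * measure m {(i, k)}"
  shows "doubly_stochastic P"
    and "sq_distortion m f fst g snd = 1 / (real CARD('n))\<^sup>2 *
      ((\<Sum>i\<in>UNIV. \<Sum>j\<in>UNIV. (f i j)\<^sup>2) + (\<Sum>k\<in>UNIV. \<Sum>l\<in>UNIV. (g k l)\<^sup>2) - 2 * overlap f g P P)"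
proof -
  interpret prob_space m using m by (simp add: couplings_def)
  have "sets m = sets (uniform \<Otimes>\<^sub>M uniform)" using m by (simp add: couplings_def)
  also have "\<dots> = sets (count_space UNIV \<Otimes>\<^sub>M count_space UNIV)"
    by (intro sets_pair_measure_cong sets_uniform_count_measure_count_space)
  also have "\<dots> = UNIV" by (subst sets_pair_countable) auto
  finally have sets: "sets m = UNIV" .
  then have space: "space m = UNIV" using sets_eq_imp_space_eq[of m "count_space UNIV"] by simp
  have unif: "measure uniform {i} = 1 / CARD('n)" for i :: 'n
    by (simp add: measure_uniform_count_measure)
  note r = couplings_realize[OF m]
  have row: "(\<Sum>k\<in>UNIV. P i k) = 1" for i
  proof -
    have "(\<Sum>k\<in>UNIV. measure m {(i, k)}) = measure m (\<Union>k. {(i, k)})"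
      by (rule finite_measure_finite_Union[symmetric]) (auto simp: sets disjoint_family_on_def)
    also have "(\<Union>k. {(i, k)}) = fst -` {i} \<inter> space m" by (auto simp: space)
    also have "measure m \<dots> = measure (distr m uniform fst) {i}"
      using r(1) by (subst measure_distr) (auto simp: realizes_def sets_uniform_count_measure)
    also have "\<dots> = 1 / CARD('n)" using r(1) unif by (simp add: realizes_def)
    finally show ?thesis by (simp add: P_def flip: sum_distrib_left)
  qed
  have col: "(\<Sum>i\<in>UNIV. P i k) = 1" for k
  proof -
    have "(\<Sum>i\<in>UNIV. measure m {(i, k)}) = measure m (\<Union>i. {(i, k)})"
      by (rule finite_measure_finite_Union[symmetric]) (auto simp: sets disjoint_family_on_def)
    also have "(\<Union>i. {(i, k)}) = snd -` {k} \<inter> space m" by (auto simp: space)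
    also have "measure m \<dots> = measure (distr m uniform snd) {k}"
      using r(2) by (subst measure_distr) (auto simp: realizes_def sets_uniform_count_measure)
    also have "\<dots> = 1 / CARD('n)" using r(2) unif by (simp add: realizes_def)
    finally show ?thesis by (simp add: P_def flip: sum_distrib_left)
  qed
  show "doubly_stochastic P" using row col by (simp add: doubly_stochastic_def P_def)
  let ?S = "\<lambda>h. \<Sum>i\<in>UNIV. \<Sum>k\<in>UNIV. \<Sum>j\<in>UNIV. \<Sum>l\<in>UNIV. P i k * P j l * h i k j l"
  have "sq_distortion m f fst g snd
    = (\<Sum>a\<in>UNIV. \<Sum>b\<in>UNIV. measure m {a} * measure m {b} * (f (fst a) (fst b) - g (snd a) (snd b))\<^sup>2)"
    unfolding sq_distortion_def
    by (subst integral_pair_finite_type) (simp_all add: sets prob_space_axioms)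
  also have "\<dots> = 1 / (real CARD('n))\<^sup>2 * ?S (\<lambda>i k j l. (f i j - g k l)\<^sup>2)"
    unfolding sum_UNIV_prod sum_distrib_left P_def
    by (intro sum.cong refl) (simp add: power2_eq_square)
  also have "?S (\<lambda>i k j l. (f i j - g k l)\<^sup>2)
      = ?S (\<lambda>i k j l. (f i j)\<^sup>2) + ?S (\<lambda>i k j l. (g k l)\<^sup>2) - 2 * overlap f g P P"
    unfolding overlap_def sum_distrib_left sum.distrib[symmetric] sum_subtractf[symmetric]
    by (intro sum.cong refl) (simp add: power2_diff algebra_simps)
  also have "?S (\<lambda>i k j l. (f i j)\<^sup>2) = (\<Sum>i\<in>UNIV. \<Sum>j\<in>UNIV. (f i j)\<^sup>2)"
  proof -
    have "?S (\<lambda>i k j l. (f i j)\<^sup>2)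
        = (\<Sum>i\<in>UNIV. \<Sum>k\<in>UNIV. P i k * (\<Sum>j\<in>UNIV. (\<Sum>l\<in>UNIV. P j l) * (f i j)\<^sup>2))"
      by (simp add: sum_distrib_left sum_distrib_right mult.assoc)
    also have "\<dots> = (\<Sum>i\<in>UNIV. (\<Sum>k\<in>UNIV. P i k) * (\<Sum>j\<in>UNIV. (\<Sum>l\<in>UNIV. P j l) * (f i j)\<^sup>2))"
      by (simp only: sum_distrib_right)
    finally show ?thesis unfolding row by simp
  qed
  also have "?S (\<lambda>i k j l. (g k l)\<^sup>2) = (\<Sum>k\<in>UNIV. \<Sum>l\<in>UNIV. (g k l)\<^sup>2)"
  proof -
    have "?S (\<lambda>i k j l. (g k l)\<^sup>2)
        = (\<Sum>k\<in>UNIV. \<Sum>i\<in>UNIV. P i k * (\<Sum>l\<in>UNIV. \<Sum>j\<in>UNIV. P j l * (g k l)\<^sup>2))"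
      by (subst sum.swap) (intro sum.cong refl, subst sum.swap, simp add: sum_distrib_left mult.assoc)
    also have "\<dots> = (\<Sum>k\<in>UNIV. (\<Sum>i\<in>UNIV. P i k) * (\<Sum>l\<in>UNIV. (\<Sum>j\<in>UNIV. P j l) * (g k l)\<^sup>2))"
      by (simp only: sum_distrib_right)
    finally show ?thesis unfolding col by simp
  qed
  finally show "sq_distortion m f fst g snd = 1 / (real CARD('n))\<^sup>2 *
      ((\<Sum>i\<in>UNIV. \<Sum>j\<in>UNIV. (f i j)\<^sup>2) + (\<Sum>k\<in>UNIV. \<Sum>l\<in>UNIV. (g k l)\<^sup>2) - 2 * overlap f g P P)" .
qed

lemma matrix_nrm_permutation:
  fixes f g :: "real^'n^'n::finite"
  assumes "bij \<sigma>"
  shows "matrix_nrm (f - relabel \<sigma> g) = sqrt (1 / (real CARD('n))\<^sup>2 *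
      ((\<Sum>i\<in>UNIV. \<Sum>j\<in>UNIV. (f $ i $ j)\<^sup>2) + (\<Sum>k\<in>UNIV. \<Sum>l\<in>UNIV. (g $ k $ l)\<^sup>2)
       - 2 * (\<Sum>i\<in>UNIV. \<Sum>j\<in>UNIV. f $ i $ j * g $ \<sigma> i $ \<sigma> j)))"
proof -
  have "(\<Sum>k\<in>UNIV. \<Sum>l\<in>UNIV. (g $ k $ l)\<^sup>2) = (\<Sum>i\<in>UNIV. \<Sum>j\<in>UNIV. (g $ \<sigma> i $ \<sigma> j)\<^sup>2)"
    using sum.reindex_bij_betw[OF assms, of "\<lambda>k. \<Sum>l\<in>UNIV. (g $ k $ l)\<^sup>2"]
      sum.reindex_bij_betw[OF assms, of "\<lambda>l. (g $ k $ l)\<^sup>2" for k] by simp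
  then show ?thesis
    unfolding matrix_nrm_def relabel_def
    by (simp add: power2_diff sum.distrib sum_subtractf sum_distrib_left mult.assoc)
qed

lemma distortion_dist_eq_matrix_dist:
  fixes f g :: "real^'n^'n::finite"
  assumes f: "f \<in> sym_matrices" "neg_type (\<lambda>i j. f $ i $ j)"
    and g: "g \<in> sym_matrices" "neg_type (\<lambda>i j. g $ i $ j)"
  shows "distortion_dist (matrix_space f) (matrix_space g) = matrix_dist f g"
proof (rule antisym)
  have "id \<in> {\<sigma> :: 'n \<Rightarrow> 'n. bij \<sigma>}" by simp
  then have ne: "{\<sigma> :: 'n \<Rightarrow> 'n. bij \<sigma>} \<noteq> {}" by blast
  show "distortion_dist (matrix_space f) (matrix_space g) \<le> matrix_dist f g"
    unfolding matrix_dist_def using ne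
    by (intro Min.boundedI) (auto intro: distortion_dist_le_permutation f g)
  show "matrix_dist f g \<le> distortion_dist (matrix_space f) (matrix_space g)"
  proof (rule distortion_dist_greatest)
    fix m assume "m \<in> couplings (mass (matrix_space f)) (mass (matrix_space g))"
    then have m: "m \<in> couplings uniform uniform" by simp
    define P where "P i k = CARD('n) * measure m {(i, k)}" for i k
    let ?f = "\<lambda>i j. f $ i $ j" and ?g = "\<lambda>i j. g $ i $ j"
    note P = sq_distortion_coupling[OF m, folded P_def]
    have "\<exists>\<sigma>. bij \<sigma> \<and> overlap ?f ?g P P \<le> (\<Sum>i\<in>UNIV. \<Sum>j\<in>UNIV. ?f i j * ?g (\<sigma> i) (\<sigma> j))"
    proof (rule overlap_le_permutation[OF P(1)])
      fix Z :: "'n \<Rightarrow> 'n \<Rightarrow> real"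
      assume "\<And>i. (\<Sum>k\<in>UNIV. Z i k) = 0" "\<And>k. (\<Sum>i\<in>UNIV. Z i k) = 0"
      then show "0 \<le> overlap ?f ?g Z Z"
        unfolding overlap_def by (rule neg_type_tensor[OF f(2) g(2)])
    qed
    then obtain \<sigma> where \<sigma>: "bij \<sigma>"
      "overlap ?f ?g P P \<le> (\<Sum>i\<in>UNIV. \<Sum>j\<in>UNIV. ?f i j * ?g (\<sigma> i) (\<sigma> j))" by blast
    have "matrix_dist f g \<le> matrix_nrm (f - relabel \<sigma> g)"
      unfolding matrix_dist_def using \<sigma>(1) by (intro Min_le) auto
    also have "\<dots> \<le> sqrt (sq_distortion m ?f fst ?g snd)"
      unfolding matrix_nrm_permutation[OF \<sigma>(1)] P(2) using \<sigma>(2)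
      by (intro real_sqrt_le_mono mult_left_mono) auto
    finally show "matrix_dist f g
        \<le> sqrt (sq_distortion m (gauging (matrix_space f)) fst (gauging (matrix_space g)) snd)"
      by simp
  qed (intro gauged_measure_space_matrix_space f g)+
qed


section \<open>The isometric embedding\<close>

lemma relabel_distance_matrix:
  "f \<in> distance_matrices \<Longrightarrow> relabel \<sigma> f \<in> distance_matrices"
  by (auto simp: distance_matrices_def sym_matrices_def relabel_def)

lemma distortion_dist_relabel:
  fixes f :: "real^'n^'n::finite"
  assumes f: "f \<in> sym_matrices" and f': "relabel \<sigma> f \<in> sym_matrices" and \<sigma>: "bij \<sigma>"
    and K: "gauged_measure_space K"
  shows "distortion_dist (matrix_space (relabel \<sigma> f)) K = distortion_dist (matrix_space f) K"
proof (rule distortion_dist_homomorphic[OF f gauged_measure_space_matrix_space[OF f'] K])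
  note gf = gauged_measure_space_matrix_space[OF f] gauged_measure_space_matrix_space[OF f']
  have "distortion_dist (matrix_space (relabel \<sigma> f)) (matrix_space f) \<le> matrix_nrm (relabel \<sigma> f - relabel \<sigma> f)"
    by (rule distortion_dist_le_permutation[OF f' f \<sigma>])
  then show "distortion_dist (matrix_space f) (matrix_space (relabel \<sigma> f)) = 0"
    using distortion_dist_nonneg[OF gf] distortion_dist_commute[OF gf] by (simp add: matrix_nrm_def)
qed

lemma relabel_id: "relabel id f = f"
  by (simp add: relabel_def vec_eq_iff)

lemma orbit_nonempty: "f \<in> relabel_orbit f"
  unfolding relabel_orbit_def by (rule CollectI, rule exI[of _ id]) (simp add: relabel_id)

lemma Phi_orbit:
  assumes f: "f \<in> distance_matrices"
  shows "Phi (relabel_orbit f) = homomorphism_class (matrix_space f)"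
  unfolding Phi_def
proof (rule the_elem_image_const)
  show "relabel_orbit f \<noteq> {}" using orbit_nonempty by blast
  fix h assume "h \<in> relabel_orbit f"
  then obtain \<sigma> where "bij \<sigma>" "h = relabel \<sigma> f" by (auto simp: relabel_orbit_def)
  moreover have "f \<in> sym_matrices" "relabel \<sigma> f \<in> sym_matrices"
    using f relabel_distance_matrix[OF f] by (auto simp: distance_matrices_def)
  ultimately show "homomorphism_class (matrix_space h) = homomorphism_class (matrix_space f)"
    by (auto simp: homomorphism_class_def homomorphic_def distortion_dist_relabel)
qed

text \<open>Independence of \<open>matrix_dist\<close> from the representatives is inherited from the distortion
  distance, with which it agrees on every pair of representatives.\<close>

lemma isometry_on_orbits:
  fixes f g :: "real^'n^'n::finite"
  assumes f: "f \<in> distance_matrices" and g: "g \<in> distance_matrices"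
    and neg: "\<And>h. h \<in> relabel_orbit f \<union> relabel_orbit g \<Longrightarrow> neg_type (\<lambda>i j. h $ i $ j)"
  shows "distortion_class_dist (Phi (relabel_orbit f)) (Phi (relabel_orbit g))
    = matrix_class_dist (relabel_orbit f) (relabel_orbit g)"
proof -
  have sym: "f \<in> sym_matrices" "g \<in> sym_matrices" "relabel \<sigma> f \<in> sym_matrices" "relabel \<sigma> g \<in> sym_matrices" for \<sigma>
    using f g relabel_distance_matrix[OF f] relabel_distance_matrix[OF g]
    by (auto simp: distance_matrices_def)
  note gauged = sym[THEN gauged_measure_space_matrix_space]
  have "matrix_class_dist (relabel_orbit f) (relabel_orbit g)
      = distortion_dist (matrix_space f) (matrix_space g)"
    unfolding matrix_class_dist_def
  proof (rule the_elem_image_const)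
    show "relabel_orbit f \<times> relabel_orbit g \<noteq> {}" using orbit_nonempty by blast
    fix z assume z: "z \<in> relabel_orbit f \<times> relabel_orbit g"
    then obtain \<sigma> \<tau> where st: "bij \<sigma>" "bij \<tau>" "z = (relabel \<sigma> f, relabel \<tau> g)"
      by (auto simp: relabel_orbit_def)
    then have "matrix_dist (relabel \<sigma> f) (relabel \<tau> g)
        = distortion_dist (matrix_space (relabel \<sigma> f)) (matrix_space (relabel \<tau> g))"
      using z by (intro distortion_dist_eq_matrix_dist[symmetric] sym neg) auto
    also have "\<dots> = distortion_dist (matrix_space f) (matrix_space (relabel \<tau> g))"
      by (rule distortion_dist_relabel[OF sym(1,3) st(1) gauged(4)])
    also have "\<dots> = distortion_dist (matrix_space (relabel \<tau> g)) (matrix_space f)"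
      by (rule distortion_dist_commute[OF gauged(1,4)])
    also have "\<dots> = distortion_dist (matrix_space g) (matrix_space f)"
      by (rule distortion_dist_relabel[OF sym(2,4) st(2) gauged(1)])
    also have "\<dots> = distortion_dist (matrix_space f) (matrix_space g)"
      by (rule distortion_dist_commute[OF gauged(2,1)])
    finally show "(case z of (f, g) \<Rightarrow> matrix_dist f g) = distortion_dist (matrix_space f) (matrix_space g)"
      by (simp add: st)
  qed
  then show ?thesis
    by (simp add: Phi_orbit f g distortion_class_dist_matrix sym)
qed

lemma neg_type_orbit_card:
  fixes f :: "real^'n^'n::finite"
  assumes "CARD('n) \<le> 4" "f \<in> distance_matrices" "h \<in> relabel_orbit f"
  shows "neg_type (\<lambda>i j. h $ i $ j)"
proof -
  have "h \<in> distance_matrices"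
    using assms relabel_distance_matrix by (auto simp: relabel_orbit_def)
  then show ?thesis
    using assms(1) by (intro neg_type_four_points) (auto simp: distance_matrices_def sym_matrices_def)
qed

lemma neg_type_orbit_euclidean:
  fixes f :: "real^'n^'n::finite"
  assumes e: "euclidean_class (relabel_orbit f)" and h: "h \<in> relabel_orbit f"
  shows "neg_type (\<lambda>i j. h $ i $ j)"
proof -
  obtain \<sigma> \<tau> where st: "bij \<sigma>" "euclidean_matrix (relabel \<sigma> f)" "h = relabel \<tau> f"
    using e h by (auto simp: euclidean_class_def relabel_orbit_def)
  obtain k and y :: "'n \<Rightarrow> nat \<Rightarrow> real" where y: "\<forall>i j. relabel \<sigma> f $ i $ j = L2_set (\<lambda>l. y i l - y j l) {..<k}"
    using st(2) unfolding euclidean_matrix_def by auto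
  have "h $ i $ j = relabel \<sigma> f $ inv \<sigma> (\<tau> i) $ inv \<sigma> (\<tau> j)" for i j
    using st(1,3) by (simp add: relabel_def bij_is_surj surj_f_inv_f)
  then show ?thesis
    using y neg_type_euclidean[of "\<lambda>i. y (inv \<sigma> (\<tau> i))" k] by simp
qed

theorem mainTheorem1:
  shows "(CARD('n::finite) \<le> 4 \<longrightarrow>
            (\<forall>D \<in> (distance_matrix_classes :: (real^'n^'n) set set).
             \<forall>D' \<in> distance_matrix_classes.
               distortion_class_dist (Phi D) (Phi D') = matrix_class_dist D D')) \<and>
         (\<forall>D \<in> (distance_matrix_classes :: (real^'n^'n) set set).
          \<forall>D' \<in> distance_matrix_classes.
            euclidean_class D \<and> euclidean_class D' \<longrightarrow>
            distortion_class_dist (Phi D) (Phi D') = matrix_class_dist D D')"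
  unfolding distance_matrix_classes_def
  by (auto intro!: isometry_on_orbits intro: neg_type_orbit_card neg_type_orbit_euclidean)

end
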